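(* Let $k > t \ge 1$ be fixed integers and let $D = \binom{k}{t} - 1$. The expected density of the $(v,k,t)$ covering produced by the random greedy covering algorithm is $$1 + O\bigl( (\log v)^{-1/D} \bigr)$$ as $v \to \infty$.
   Context: A $(v,k,t)$ covering is a family of $k$-subsets, called blocks, of a fixed $v$-set such that every $t$-subset of the $v$-set is contained in at least one block. Its density is the average, over all $t$-subsets, of the number of blocks containing the $t$-subset; equivalently, $(\text{number of blocks}) \cdot \binom{k}{t} / \binom{v}{t}$. Random greedy $(v,k,t)$ covering algorithm: (1) Fix a uniformly random ordering of all $k$-subsets of the $v$-set. (2) Choose the earliest $k$-set in the ordering that contains no already-covered $t$-set (a $t$-set is already covered if it is contained in a previously chosen $k$-set). (3) Repeat step (2) until no $k$-set can be chosen. (4) For each $t$-set still uncovered at this point, add one $k$-set containing it. The output is the family of all chosen and added $k$-sets. The expectation is over the random ordering; the implied constant may depend on $k$ and $t$. *)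

theory Defs
  imports
    "HOL-Probability.Random_Permutations"
    "HOL-Library.Ramsey"
    "HOL-Library.While_Combinator"
begin

text \<open>
  The \<open>v\<close>-set is \<open>{..<v}\<close>, and \<open>nsets X k\<close> is the set of \<open>k\<close>-subsets of \<open>X\<close>. A family of blocks
  is a multiset: blocks added for different uncovered \<open>t\<close>-sets may coincide, and are then
  counted once for each of these \<open>t\<close>-sets.
\<close>

definition covering :: "nat \<Rightarrow> nat \<Rightarrow> nat \<Rightarrow> nat set multiset \<Rightarrow> bool" where
  "covering v k t F \<longleftrightarrow>
     set_mset F \<subseteq> nsets {..<v} k \<and> (\<forall>T\<in>nsets {..<v} t. \<exists>B\<in>#F. T \<subseteq> B)"

definition density :: "nat \<Rightarrow> nat \<Rightarrow> nat set multiset \<Rightarrow> real" where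
  "density v t F =
     (\<Sum>T\<in>nsets {..<v} t. real (size {#B \<in># F. T \<subseteq> B#})) / real (card (nsets {..<v} t))"

definition covered :: "nat set set \<Rightarrow> nat set \<Rightarrow> bool" where
  "covered C T \<longleftrightarrow> (\<exists>B\<in>C. T \<subseteq> B)"

definition available :: "nat \<Rightarrow> nat set set \<Rightarrow> nat set \<Rightarrow> bool" where
  "available t C B \<longleftrightarrow> (\<forall>T\<in>nsets B t. \<not> covered C T)"

text \<open>
  An ordering of the \<open>k\<close>-sets is a list, so \<open>find\<close> returns the earliest available one. For
  \<open>t \<le> k\<close> a chosen \<open>k\<close>-set is no longer available, hence the loop terminates.
\<close>

definition greedy_chosen :: "nat \<Rightarrow> nat set list \<Rightarrow> nat set set" where
  "greedy_chosen t ord =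
     while (\<lambda>C. \<exists>B\<in>set ord. available t C B)
           (\<lambda>C. insert (the (find (available t C) ord)) C)
           {}"

definition uncovered :: "nat \<Rightarrow> nat \<Rightarrow> nat set list \<Rightarrow> nat set set" where
  "uncovered v t ord = {T \<in> nsets {..<v} t. \<not> covered (greedy_chosen t ord) T}"

text \<open>
  The algorithm does not say which \<open>k\<close>-set is added for an uncovered \<open>t\<close>-set. This is a
  parameter \<open>add\<close>, which may depend on the ordering, and hence on the whole run.
\<close>

definition completion_rule ::
    "nat \<Rightarrow> nat \<Rightarrow> nat \<Rightarrow> (nat set list \<Rightarrow> nat set \<Rightarrow> nat set) \<Rightarrow> bool" where
  "completion_rule v k t add \<longleftrightarrow>
     (\<forall>ord\<in>permutations_of_set (nsets {..<v} k). \<forall>T\<in>uncovered v t ord.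
        add ord T \<in> nsets {..<v} k \<and> T \<subseteq> add ord T)"

definition greedy_covering ::
    "nat \<Rightarrow> nat \<Rightarrow> (nat set list \<Rightarrow> nat set \<Rightarrow> nat set) \<Rightarrow> nat set list \<Rightarrow> nat set multiset" where
  "greedy_covering v t add ord =
     mset_set (greedy_chosen t ord) + image_mset (add ord) (mset_set (uncovered v t ord))"

definition expected_density ::
    "nat \<Rightarrow> nat \<Rightarrow> nat \<Rightarrow> (nat set list \<Rightarrow> nat set \<Rightarrow> nat set) \<Rightarrow> real" where
  "expected_density v k t add =
     measure_pmf.expectation (pmf_of_set (permutations_of_set (nsets {..<v} k)))
       (\<lambda>ord. density v t (greedy_covering v t add ord))"

lemma greedy_chosen_subset:
  assumes "\<And>B. B \<in> set ord \<Longrightarrow> card B = k" and "t \<le> k" and "\<And>B. B \<in> set ord \<Longrightarrow> finite B"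
  shows "greedy_chosen t ord \<subseteq> set ord"
    and "B \<in> set ord \<Longrightarrow> \<not> available t (greedy_chosen t ord) B"
proof -
  have *: "the (find (available t C) ord) \<in> set ord
      \<and> available t C (the (find (available t C) ord))"
    if ex: "\<exists>B\<in>set ord. available t C B" for C
  proof -
    obtain B where "find (available t C) ord = Some B"
      using ex find_None_iff[of "available t C" ord] by auto
    moreover from this obtain i where "i < length ord" "available t C (ord ! i)" "B = ord ! i"
      unfolding find_Some_iff by blast
    ultimately show ?thesis
      by simp
  qed
  have new: "B \<notin> C" if B: "B \<in> set ord" "available t C B" for B C
  proof -
    obtain T where "T \<subseteq> B" "card T = t" "finite T"
      using obtain_subset_with_card_n[of t B] assms(1)[OF B(1)] assms(2) by metis
    then show ?thesis
      using B(2) by (auto simp: available_def covered_def nsets_def)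
  qed
  have "greedy_chosen t ord \<subseteq> set ord
      \<and> \<not> (\<exists>B\<in>set ord. available t (greedy_chosen t ord) B)"
    unfolding greedy_chosen_def
  proof (rule while_rule[where P = "\<lambda>C. C \<subseteq> set ord"
        and r = "Wellfounded.measure (\<lambda>C. card (set ord - C))"])
    fix C assume C: "C \<subseteq> set ord" "\<exists>B\<in>set ord. available t C B"
    show "insert (the (find (available t C) ord)) C \<subseteq> set ord"
      using *[OF C(2)] C(1) by simp
    show "(insert (the (find (available t C) ord)) C, C)
        \<in> Wellfounded.measure (\<lambda>C. card (set ord - C))"
      using *[OF C(2)] new[of "the (find (available t C) ord)" C]
      unfolding in_measure by (intro psubset_card_mono) auto
  qed auto
  then show "greedy_chosen t ord \<subseteq> set ord"
    and "B \<in> set ord \<Longrightarrow> \<not> available t (greedy_chosen t ord) B"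
    by auto
qed

lemma covering_greedy_covering:
  assumes "t \<le> k" and ord: "ord \<in> permutations_of_set (nsets {..<v} k)"
    and add: "completion_rule v k t add"
  shows "covering v k t (greedy_covering v t add ord)"
proof -
  have set_ord: "set ord = nsets {..<v} k"
    using ord by (simp add: permutations_of_set_def)
  have sub: "greedy_chosen t ord \<subseteq> nsets {..<v} k"
    unfolding set_ord[symmetric]
  proof (rule greedy_chosen_subset(1)[OF _ assms(1)])
    show "card B = k" "finite B" if "B \<in> set ord" for B
      using that unfolding set_ord by (simp_all add: nsets_def)
  qed
  have fin: "finite (nsets {..<v} n)" for n
    by (simp add: finite_imp_finite_nsets)
  have fin': "finite (greedy_chosen t ord)" "finite (uncovered v t ord)"
    using finite_subset[OF sub fin] fin by (auto simp: uncovered_def)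
  have rule: "add ord T \<in> nsets {..<v} k \<and> T \<subseteq> add ord T" if "T \<in> uncovered v t ord" for T
    using add ord that by (auto simp: completion_rule_def)
  have "\<exists>B\<in>#greedy_covering v t add ord. T \<subseteq> B" if "T \<in> nsets {..<v} t" for T
  proof (cases "T \<in> uncovered v t ord")
    case True
    then show ?thesis
      using rule[OF True] fin' by (auto simp: greedy_covering_def)
  next
    case False
    then show ?thesis
      using that fin' by (auto simp: uncovered_def covered_def greedy_covering_def)
  qed
  then show ?thesis
    using sub rule fin' by (auto simp: covering_def greedy_covering_def)
qed

end

theory Submission
  imports Defs "HOL-Real_Asymp.Real_Asymp"
begin

text \<open>
  The chosen blocks cover no \<open>t\<close>-set twice, so the density is \<open>1 + D u\<close>, where \<open>u\<close> is the
  fraction of \<open>t\<close>-sets that they leave uncovered. The greedy algorithm scans the ordering once, and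
  the set \<open>U\<^sub>i\<close> of \<open>t\<close>-sets uncovered after \<open>i\<close> scanned blocks is a Markov chain: a scanned block
  is never available again, so the drift of a function of \<open>U\<^sub>i\<close> is a sum over all blocks.

  Let \<open>n\<close> be the number of blocks, \<open>N\<close> the number of blocks containing a given \<open>t\<close>-set, and
  \<open>s = i N / n\<close> the time. One step back in time enlarges the set of \<open>t\<close>-sets on which a function
  depends by at most \<open>D\<close>, and a block rarely meets two given \<open>t\<close>-sets. By a discrete Gronwall
  argument, functions bounded by \<open>1\<close> and depending on disjoint sets \<open>X\<close> and \<open>Y\<close> of \<open>t\<close>-sets
  therefore have covariance \<open>O(|X| |Y| (1 + s) e\<^bsup>4 D s\<^esup> / v)\<close>. Up to \<open>s = ln v / (8 D)\<close> this is
  \<open>v\<^bsup>-1/2 + o(1)\<^esup>\<close>, so the \<open>D + 1\<close> many \<open>t\<close>-sets of a block are almost independent. Hence the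
  probability \<open>u(s)\<close> that a \<open>t\<close>-set is uncovered, which by symmetry is the same for all \<open>t\<close>-sets,
  satisfies \<open>u' \<le> - u\<^bsup>D + 1\<^esup> + v\<^bsup>-1/2 + o(1)\<^esup>\<close>, and this gives \<open>u(s) = O(s\<^bsup>-1/D\<^esup>)\<close>.
\<close>

section \<open>Uniformly random orderings\<close>

text \<open>Given the first \<open>i\<close> entries of a uniform ordering, the next one is uniform
  on the rest. Swapping positions \<open>i\<close> and \<open>j\<close> with
  \<open>i \<le> j\<close> is an involution of the orderings that keeps these entries. So all
  positions from \<open>i\<close> on give the same sum, and together they run through the remaining
  elements.\<close>

lemma sum_permutations_next:
  fixes \<phi> :: "'a list \<Rightarrow> 'a \<Rightarrow> real"
  assumes "finite A" and "i < card A"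
  shows "real (card A - i) * (\<Sum>\<omega>\<in>permutations_of_set A. \<phi> (take i \<omega>) (\<omega> ! i))
    = (\<Sum>\<omega>\<in>permutations_of_set A. \<Sum>a\<in>A - set (take i \<omega>). \<phi> (take i \<omega>) a)"
proof -
  have len: "length \<omega> = card A" if "\<omega> \<in> permutations_of_set A" for \<omega>
    using that by (rule length_finite_permutations_of_set)
  define sw where "sw \<omega> j = list_update (list_update \<omega> i (\<omega> ! j)) j (\<omega> ! i)" for \<omega> :: "'a list" and j
  have swap: "(\<Sum>\<omega>\<in>permutations_of_set A. \<phi> (take i \<omega>) (\<omega> ! j))
      = (\<Sum>\<omega>\<in>permutations_of_set A. \<phi> (take i \<omega>) (\<omega> ! i))"
    if j: "i \<le> j" "j < card A" for j
  proof (rule sum.reindex_bij_witness[where i = "\<lambda>\<omega>. sw \<omega> j" and j = "\<lambda>\<omega>. sw \<omega> j"])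
    fix \<omega> assume \<omega>: "\<omega> \<in> permutations_of_set A"
    note l = len[OF \<omega>]
    show "sw \<omega> j \<in> permutations_of_set A"
      using \<omega> l j assms by (auto simp: permutations_of_set_def sw_def)
    show "sw (sw \<omega> j) j = \<omega>"
    proof (rule nth_equalityI)
      fix m assume "m < length (sw (sw \<omega> j) j)"
      then have "m < length \<omega>"
        by (simp add: sw_def)
      then show "sw (sw \<omega> j) j ! m = \<omega> ! m"
        using l j assms(2) by (cases "m = i"; cases "m = j"; cases "i = j") (simp_all add: sw_def)
    qed (simp add: sw_def)
    then show "sw (sw \<omega> j) j = \<omega>" .
    show "\<phi> (take i (sw \<omega> j)) (sw \<omega> j ! i) = \<phi> (take i \<omega>) (\<omega> ! j)"
      using l j assms by (auto simp: nth_list_update sw_def)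
  qed (use len j assms in \<open>auto simp: permutations_of_set_def sw_def\<close>)
  have "real (card A - i) * (\<Sum>\<omega>\<in>permutations_of_set A. \<phi> (take i \<omega>) (\<omega> ! i))
      = (\<Sum>j\<in>{i..<card A}. \<Sum>\<omega>\<in>permutations_of_set A. \<phi> (take i \<omega>) (\<omega> ! j))"
  proof -
    have "(\<Sum>j\<in>{i..<card A}. \<Sum>\<omega>\<in>permutations_of_set A. \<phi> (take i \<omega>) (\<omega> ! j))
        = (\<Sum>j\<in>{i..<card A}. \<Sum>\<omega>\<in>permutations_of_set A. \<phi> (take i \<omega>) (\<omega> ! i))"
      by (intro sum.cong[OF refl] swap) auto
    then show ?thesis
      by simp
  qed
  also have "\<dots> = (\<Sum>\<omega>\<in>permutations_of_set A. \<Sum>j\<in>{i..<card A}. \<phi> (take i \<omega>) (\<omega> ! j))"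
    by (rule sum.swap)
  also have "\<dots> = (\<Sum>\<omega>\<in>permutations_of_set A. \<Sum>a\<in>A - set (take i \<omega>). \<phi> (take i \<omega>) a)"
  proof (rule sum.cong[OF refl])
    fix \<omega> assume \<omega>: "\<omega> \<in> permutations_of_set A"
    have d: "distinct \<omega>" "set \<omega> = A"
      using \<omega> by (auto simp: permutations_of_set_def)
    have "set (take i \<omega>) \<union> set (drop i \<omega>) = A"
      using d by (metis append_take_drop_id set_append)
    moreover have "set (take i \<omega>) \<inter> set (drop i \<omega>) = {}"
      using d by (intro set_take_disj_set_drop_if_distinct) auto
    ultimately have "A - set (take i \<omega>) = set (drop i \<omega>)"
      by blast
    also have "\<dots> = (!) \<omega> ` {i..<card A}"
      using len[OF \<omega>] by (auto simp: drop_eq_nths set_nths)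
    finally have "bij_betw ((!) \<omega>) {i..<card A} (A - set (take i \<omega>))"
      using d len[OF \<omega>] by (auto simp: bij_betw_def inj_on_def nth_eq_iff_index_eq)
    then show "(\<Sum>j\<in>{i..<card A}. \<phi> (take i \<omega>) (\<omega> ! j))
        = (\<Sum>a\<in>A - set (take i \<omega>). \<phi> (take i \<omega>) a)"
      by (rule sum.reindex_bij_betw)
  qed
  finally show ?thesis .
qed

text \<open>By Bernoulli's inequality the product is at most \<open>(1 - z\<^sup>2) ^ n\<close>.
  This carries the induction step in \<open>mean_mem_bound\<close>.\<close>

lemma one_plus_mult_power_le_1:
  fixes z :: real
  assumes "0 \<le> z" and "z \<le> 1"
  shows "(1 + real n * z) * (1 - z) ^ n \<le> 1"
proof -
  have "(1 + real n * z) * (1 - z) ^ n \<le> (1 + z) ^ n * (1 - z) ^ n"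
    using assms Bernoulli_inequality[of z n] by (intro mult_right_mono) auto
  also have "\<dots> = (1 - z\<^sup>2) ^ n"
    by (simp add: power2_eq_square algebra_simps flip: power_mult_distrib)
  also have "\<dots> \<le> 1"
    using assms by (intro power_le_one) (auto simp: power_le_one)
  finally show ?thesis .
qed

subsection \<open>The random greedy matching of a hypergraph\<close>

text \<open>Vertices stand for \<open>t\<close>-sets and edges for \<open>k\<close>-sets, with
  \<open>S B\<close> the \<open>t\<close>-subsets of \<open>B\<close>. The edge size is
  \<open>Suc D\<close> because \<open>D\<close> is the exponent in the final rate.\<close>

locale transitive_hypergraph =
  fixes E :: "'e set" and V :: "'x set" and S :: "'e \<Rightarrow> 'x set" and D N \<Delta> :: nat
  assumes finite_E: "finite E" and finite_V: "finite V"
    and S_subset: "\<And>B. B \<in> E \<Longrightarrow> S B \<subseteq> V"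
    and card_S: "\<And>B. B \<in> E \<Longrightarrow> card (S B) = Suc D"
    and degree: "\<And>x. x \<in> V \<Longrightarrow> card {B \<in> E. x \<in> S B} = N"
    and codegree: "\<And>x y. x \<in> V \<Longrightarrow> y \<in> V \<Longrightarrow> x \<noteq> y \<Longrightarrow> card {B \<in> E. x \<in> S B \<and> y \<in> S B} \<le> \<Delta>"
    and transitive: "\<And>x y. x \<in> V \<Longrightarrow> y \<in> V \<Longrightarrow>
      \<exists>\<sigma> p. bij_betw \<sigma> E E \<and> bij_betw p V V \<and> p x = y \<and> (\<forall>B\<in>E. S (\<sigma> B) = p ` S B)"
    and E_nonempty: "E \<noteq> {}"
begin

text \<open>The state of the process is the uncovered set alone: a scanned edge contained in it is
  chosen, any other edge is skipped.\<close>

definition hit :: "'e \<Rightarrow> 'x set \<Rightarrow> 'x set" where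
  "hit B U = (if S B \<subseteq> U then U - S B else U)"

definition residual :: "'e list \<Rightarrow> 'x set" where
  "residual = foldl (\<lambda>U B. hit B U) V"

definition mean :: "nat \<Rightarrow> ('x set \<Rightarrow> real) \<Rightarrow> real" where
  "mean i h = (\<Sum>\<omega>\<in>permutations_of_set E. h (residual (take i \<omega>))) / fact (card E)"

lemma hit_subset: "hit B U \<subseteq> U"
  by (auto simp: hit_def)

lemma residual_Nil [simp]: "residual [] = V"
  and residual_snoc: "residual (xs @ [B]) = hit B (residual xs)"
  by (simp_all add: residual_def)

lemma residual_append_subset: "residual (xs @ ys) \<subseteq> residual xs"
proof (induction ys rule: rev_induct)
  case (snoc y ys)
  then show ?case
    using residual_snoc[of "xs @ ys" y] hit_subset by fastforce
qed simp

lemma S_nonempty: "B \<in> E \<Longrightarrow> S B \<noteq> {}"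
  using card_S by fastforce

text \<open>If all vertices of \<open>B\<close> are uncovered when \<open>B\<close> is scanned, then
  \<open>B\<close> is chosen and they are removed. In either case a vertex is missing afterwards,
  and residual sets only shrink.\<close>

lemma not_S_subset_residual:
  assumes "B \<in> E" and "B \<in> set xs"
  shows "\<not> S B \<subseteq> residual xs"
proof -
  obtain ys zs where xs: "xs = (ys @ [B]) @ zs"
    using assms(2) by (metis append.assoc append_Cons append_Nil in_set_conv_decomp)
  have "\<not> S B \<subseteq> hit B (residual ys)"
    using S_nonempty[OF assms(1)] by (auto simp: hit_def)
  then show ?thesis
    unfolding xs using residual_append_subset[of "ys @ [B]" zs] by (auto simp: residual_snoc)
qed

lemma mean_diff: "mean i (\<lambda>U. f U - g U) = mean i f - mean i g"
  and mean_cmult: "mean i (\<lambda>U. c * f U) = c * mean i f"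
  and mean_const: "mean i (\<lambda>U. c) = c"
  using finite_E
  by (simp_all add: mean_def sum.distrib sum_subtractf sum_distrib_left add_divide_distrib
      diff_divide_distrib)

lemma mean_0: "mean 0 h = h V"
  using finite_E by (simp add: mean_def)

lemma mean_mono:
  assumes "\<And>U. f U \<le> g U"
  shows "mean i f \<le> mean i g"
  unfolding mean_def using assms by (intro divide_right_mono sum_mono) auto

lemma abs_mean_le:
  assumes "\<And>U. \<bar>f U\<bar> \<le> c"
  shows "\<bar>mean i f\<bar> \<le> c"
proof -
  have "- c \<le> f U" "f U \<le> c" for U
    using assms[of U] by auto
  then show ?thesis
    using mean_mono[of f "\<lambda>_. c" i] mean_mono[of "\<lambda>_. - c" f i] by (simp add: mean_const)
qed

text \<open>The next edge is uniform among the \<open>card E - i\<close> unscanned ones. Scanned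
  edges would not change the residual set again, so the sum may run over all of \<open>E\<close>,
  whatever the past.\<close>

lemma mean_Suc:
  assumes i: "i < card E"
  shows "mean (Suc i) h
    = mean i h + (\<Sum>B\<in>E. mean i (\<lambda>U. h (hit B U)) - mean i h) / real (card E - i)"
proof -
  define \<phi> where "\<phi> xs B = h (hit B (residual xs)) - h (residual xs)" for xs B
  let ?P = "permutations_of_set E"
  have "(\<Sum>\<omega>\<in>?P. h (residual (take (Suc i) \<omega>)))
      = (\<Sum>\<omega>\<in>?P. h (residual (take i \<omega>)) + \<phi> (take i \<omega>) (\<omega> ! i))"
  proof (rule sum.cong[OF refl])
    fix \<omega> assume "\<omega> \<in> ?P"
    then have "take (Suc i) \<omega> = take i \<omega> @ [\<omega> ! i]"
      using i length_finite_permutations_of_set by (metis take_Suc_conv_app_nth)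
    then show "h (residual (take (Suc i) \<omega>)) = h (residual (take i \<omega>)) + \<phi> (take i \<omega>) (\<omega> ! i)"
      by (simp add: \<phi>_def residual_snoc)
  qed
  also have "\<dots> = (\<Sum>\<omega>\<in>?P. h (residual (take i \<omega>))) + (\<Sum>\<omega>\<in>?P. \<phi> (take i \<omega>) (\<omega> ! i))"
    by (rule sum.distrib)
  also have "(\<Sum>\<omega>\<in>?P. \<phi> (take i \<omega>) (\<omega> ! i))
      = (\<Sum>\<omega>\<in>?P. \<Sum>B\<in>E - set (take i \<omega>). \<phi> (take i \<omega>) B) / real (card E - i)"
    using sum_permutations_next[OF finite_E i, of \<phi>] i by (simp add: field_simps)
  also have "(\<Sum>\<omega>\<in>?P. \<Sum>B\<in>E - set (take i \<omega>). \<phi> (take i \<omega>) B) = (\<Sum>\<omega>\<in>?P. \<Sum>B\<in>E. \<phi> (take i \<omega>) B)"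
  proof (intro sum.cong[OF refl] sum.mono_neutral_left)
    fix \<omega>
    show "\<forall>B\<in>E - (E - set (take i \<omega>)). \<phi> (take i \<omega>) B = 0"
      using not_S_subset_residual by (auto simp: \<phi>_def hit_def)
  qed (use finite_E in auto)
  also have "\<dots> = (\<Sum>B\<in>E. \<Sum>\<omega>\<in>?P. \<phi> (take i \<omega>) B)"
    by (rule sum.swap)
  finally have "mean (Suc i) h
      = mean i h + (\<Sum>B\<in>E. \<Sum>\<omega>\<in>?P. \<phi> (take i \<omega>) B) / real (card E - i) / fact (card E)"
    by (simp add: mean_def add_divide_distrib)
  also have "(\<Sum>B\<in>E. \<Sum>\<omega>\<in>?P. \<phi> (take i \<omega>) B) / real (card E - i) / fact (card E)
      = (\<Sum>B\<in>E. (\<Sum>\<omega>\<in>?P. \<phi> (take i \<omega>) B) / fact (card E)) / real (card E - i)"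
    by (simp add: sum_divide_distrib mult.commute)
  finally show ?thesis
    by (simp add: mean_def \<phi>_def sum_subtractf diff_divide_distrib)
qed

section \<open>Covariance of functions of disjoint vertex sets\<close>

definition local_on :: "'x set \<Rightarrow> ('x set \<Rightarrow> real) \<Rightarrow> bool" where
  "local_on X h \<longleftrightarrow> (\<forall>U. h U = h (U \<inter> X))"

text \<open>On \<open>X\<close>, the set \<open>hit B U\<close> is determined by \<open>U\<close> on
  \<open>X\<close> and on \<open>S B\<close>. This is how one step back in time enlarges the set on
  which a function depends.\<close>

lemma local_on_hit:
  assumes "local_on X h"
  shows "local_on (X \<union> S B) (\<lambda>U. h (hit B U))"
proof -
  have "hit B U \<inter> X = hit B (U \<inter> (X \<union> S B)) \<inter> X" for U
    by (auto simp: hit_def)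
  then show ?thesis
    using assms unfolding local_on_def by metis
qed

lemma local_on_hit_disjoint:
  assumes "local_on X h" and "S B \<inter> X = {}"
  shows "h (hit B U) = h U"
proof -
  have "hit B U \<inter> X = U \<inter> X"
    using assms(2) by (auto simp: hit_def)
  then show ?thesis
    using assms(1) unfolding local_on_def by metis
qed

definition cov :: "nat \<Rightarrow> ('x set \<Rightarrow> real) \<Rightarrow> ('x set \<Rightarrow> real) \<Rightarrow> real" where
  "cov i f g = mean i (\<lambda>U. f U * g U) - mean i f * mean i g"

lemma abs_cov_le:
  assumes "\<And>U. \<bar>f U\<bar> \<le> 1" and "\<And>U. \<bar>g U\<bar> \<le> 1"
  shows "\<bar>cov i f g\<bar> \<le> 2"
proof -
  have "\<bar>mean i (\<lambda>U. f U * g U)\<bar> \<le> 1"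
    using assms by (intro abs_mean_le) (simp add: abs_mult mult_le_one)
  moreover have "\<bar>mean i f * mean i g\<bar> \<le> 1"
    using abs_mean_le[OF assms(1)] abs_mean_le[OF assms(2)] by (simp add: abs_mult mult_le_one)
  ultimately show ?thesis
    by (simp add: cov_def)
qed

lemma card_meeting_le:
  assumes "X \<subseteq> V"
  shows "card {B \<in> E. S B \<inter> X \<noteq> {}} \<le> card X * N"
proof -
  have "{B \<in> E. S B \<inter> X \<noteq> {}} = (\<Union>x\<in>X. {B \<in> E. x \<in> S B})"
    by auto
  also have "card \<dots> \<le> (\<Sum>x\<in>X. card {B \<in> E. x \<in> S B})"
    using assms finite_V finite_subset by (blast intro: card_UN_le)
  also have "\<dots> = card X * N"
    using assms degree by (simp add: subset_iff)
  finally show ?thesis .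
qed

lemma card_meeting_both_le:
  assumes "X \<subseteq> V" and "Y \<subseteq> V" and "X \<inter> Y = {}"
  shows "card {B \<in> E. S B \<inter> X \<noteq> {} \<and> S B \<inter> Y \<noteq> {}} \<le> card X * card Y * \<Delta>"
proof -
  have fin: "finite X" "finite Y"
    using assms finite_V by (auto intro: finite_subset)
  have "{B \<in> E. S B \<inter> X \<noteq> {} \<and> S B \<inter> Y \<noteq> {}} = (\<Union>(x, y)\<in>X \<times> Y. {B \<in> E. x \<in> S B \<and> y \<in> S B})"
    by auto
  also have "card \<dots> \<le> (\<Sum>(x, y)\<in>X \<times> Y. card {B \<in> E. x \<in> S B \<and> y \<in> S B})"
    using card_UN_le[of "X \<times> Y" "\<lambda>(x, y). {B \<in> E. x \<in> S B \<and> y \<in> S B}"] fin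
    by (simp add: case_prod_beta)
  also have "\<dots> \<le> (\<Sum>(x, y)\<in>X \<times> Y. \<Delta>)"
    using assms by (intro sum_mono) (auto intro!: codegree)
  finally show ?thesis
    by (simp add: card_cartesian_product)
qed

text \<open>An edge meeting only \<open>X\<close> leaves \<open>g\<close> unchanged, so it
  contributes \<open>cov i (\<lambda>U. f (hit B U)) g - cov i f g\<close>, and symmetrically for
  \<open>Y\<close>. Edges meeting neither set contribute nothing. Edges meeting both, and the
  product of the two drifts, remain as error terms.\<close>

lemma cov_Suc:
  fixes f g X Y
  defines "M \<equiv> \<lambda>Z. {B \<in> E. S B \<inter> Z \<noteq> {}}"
    and "\<delta> \<equiv> \<lambda>i h B. mean i (\<lambda>U. h (hit B U)) - mean i h"
  assumes i: "i < card E" and f: "local_on X f" and g: "local_on Y g"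
  defines "a \<equiv> 1 / real (card E - i)"
  shows "cov (Suc i) f g
    = (1 - a * (real (card (M X - M Y)) + real (card (M Y - M X)))) * cov i f g
      + a * (\<Sum>B\<in>M X - M Y. cov i (\<lambda>U. f (hit B U)) g)
      + a * (\<Sum>B\<in>M Y - M X. cov i f (\<lambda>U. g (hit B U)))
      + a * (\<Sum>B\<in>M X \<inter> M Y. \<delta> i (\<lambda>U. f U * g U) B - \<delta> i f B * mean i g - mean i f * \<delta> i g B)
      - a\<^sup>2 * (\<Sum>B\<in>M X. \<delta> i f B) * (\<Sum>B\<in>M Y. \<delta> i g B)"
proof -
  let ?P = "M X - M Y" and ?Q = "M Y - M X" and ?R = "M X \<inter> M Y"
  have fin: "finite (M Z)" for Z
    using finite_E by (simp add: M_def)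
  have f0: "f (hit B U) = f U" if "B \<in> E" "B \<notin> M X" for B U
    using that local_on_hit_disjoint[OF f, of B U] by (auto simp: M_def)
  have g0: "g (hit B U) = g U" if "B \<in> E" "B \<notin> M Y" for B U
    using that local_on_hit_disjoint[OF g, of B U] by (auto simp: M_def)
  have ME: "M Z \<subseteq> E" for Z
    by (auto simp: M_def)
  have F: "(\<Sum>B\<in>E. \<delta> i f B) = (\<Sum>B\<in>M X. \<delta> i f B)"
    using f0 ME finite_E by (intro sum.mono_neutral_right) (auto simp: \<delta>_def)
  have G: "(\<Sum>B\<in>E. \<delta> i g B) = (\<Sum>B\<in>M Y. \<delta> i g B)"
    using g0 ME finite_E by (intro sum.mono_neutral_right) (auto simp: \<delta>_def)
  have F': "(\<Sum>B\<in>M X. \<delta> i f B) = (\<Sum>B\<in>?P. \<delta> i f B) + (\<Sum>B\<in>?R. \<delta> i f B)"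
    by (subst sum.Int_Diff[OF fin, of _ X "M Y"]) (rule add.commute)
  have G': "(\<Sum>B\<in>M Y. \<delta> i g B) = (\<Sum>B\<in>?Q. \<delta> i g B) + (\<Sum>B\<in>?R. \<delta> i g B)"
    by (subst sum.Int_Diff[OF fin, of _ Y "M X"], subst Int_commute) (rule add.commute)
  have "(\<Sum>B\<in>E. \<delta> i (\<lambda>U. f U * g U) B) = (\<Sum>B\<in>(?P \<union> ?Q) \<union> ?R. \<delta> i (\<lambda>U. f U * g U) B)"
  proof (rule sum.mono_neutral_right[OF finite_E])
    show "(?P \<union> ?Q) \<union> ?R \<subseteq> E"
      using ME[of X] ME[of Y] by blast
    show "\<forall>B\<in>E - ((?P \<union> ?Q) \<union> ?R). \<delta> i (\<lambda>U. f U * g U) B = 0"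
    proof
      fix B assume "B \<in> E - ((?P \<union> ?Q) \<union> ?R)"
      then have "B \<in> E" "B \<notin> M X" "B \<notin> M Y"
        by blast+
      then show "\<delta> i (\<lambda>U. f U * g U) B = 0"
        by (simp add: \<delta>_def f0 g0)
    qed
  qed
  also have "\<dots> = (\<Sum>B\<in>?P. \<delta> i (\<lambda>U. f U * g U) B) + (\<Sum>B\<in>?Q. \<delta> i (\<lambda>U. f U * g U) B)
      + (\<Sum>B\<in>?R. \<delta> i (\<lambda>U. f U * g U) B)"
  proof -
    have "(?P \<union> ?Q) \<inter> ?R = {}" "?P \<inter> ?Q = {}"
      by blast+
    then show ?thesis
      using fin by (simp only: sum.union_disjoint finite_Un finite_Diff finite_Int simp_thms)
  qed
  finally have FG: "(\<Sum>B\<in>E. \<delta> i (\<lambda>U. f U * g U) B)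
      = (\<Sum>B\<in>?P. \<delta> i (\<lambda>U. f U * g U) B) + (\<Sum>B\<in>?Q. \<delta> i (\<lambda>U. f U * g U) B)
        + (\<Sum>B\<in>?R. \<delta> i (\<lambda>U. f U * g U) B)" .
  have P: "(\<Sum>B\<in>?P. cov i (\<lambda>U. f (hit B U)) g)
      = (\<Sum>B\<in>?P. \<delta> i (\<lambda>U. f U * g U) B) - (\<Sum>B\<in>?P. \<delta> i f B) * mean i g + card ?P * cov i f g"
  proof -
    have "cov i (\<lambda>U. f (hit B U)) g = \<delta> i (\<lambda>U. f U * g U) B - \<delta> i f B * mean i g + cov i f g"
      if "B \<in> ?P" for B
    proof -
      have "B \<in> E" "B \<notin> M Y"
        using that ME by auto
      then show ?thesis
        using g0[of B] by (simp add: cov_def \<delta>_def algebra_simps)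
    qed
    then show ?thesis
      by (simp add: sum.distrib sum_subtractf sum_distrib_right)
  qed
  have Q: "(\<Sum>B\<in>?Q. cov i f (\<lambda>U. g (hit B U)))
      = (\<Sum>B\<in>?Q. \<delta> i (\<lambda>U. f U * g U) B) - mean i f * (\<Sum>B\<in>?Q. \<delta> i g B) + card ?Q * cov i f g"
  proof -
    have "cov i f (\<lambda>U. g (hit B U)) = \<delta> i (\<lambda>U. f U * g U) B - mean i f * \<delta> i g B + cov i f g"
      if "B \<in> ?Q" for B
    proof -
      have "B \<in> E" "B \<notin> M X"
        using that ME by auto
      then show ?thesis
        using f0[of B] by (simp add: cov_def \<delta>_def algebra_simps)
    qed
    then show ?thesis
      by (simp add: sum.distrib sum_subtractf sum_distrib_left)
  qed
  have R: "(\<Sum>B\<in>?R. \<delta> i (\<lambda>U. f U * g U) B - \<delta> i f B * mean i g - mean i f * \<delta> i g B)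
      = (\<Sum>B\<in>?R. \<delta> i (\<lambda>U. f U * g U) B) - (\<Sum>B\<in>?R. \<delta> i f B) * mean i g
        - mean i f * (\<Sum>B\<in>?R. \<delta> i g B)"
    by (simp add: sum_subtractf sum_distrib_left sum_distrib_right)
  have step: "mean (Suc i) h = mean i h + a * (\<Sum>B\<in>E. \<delta> i h B)" for h
    using mean_Suc[OF i, of h] by (simp add: a_def \<delta>_def)
  have "cov (Suc i) f g = mean i (\<lambda>U. f U * g U) + a * (\<Sum>B\<in>E. \<delta> i (\<lambda>U. f U * g U) B)
      - (mean i f + a * (\<Sum>B\<in>E. \<delta> i f B)) * (mean i g + a * (\<Sum>B\<in>E. \<delta> i g B))"
    by (simp add: cov_def step)
  then show ?thesis
    unfolding F G FG P Q R F' G' by (simp add: cov_def power2_eq_square algebra_simps)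
qed

text \<open>In \<open>cov_Suc\<close>, the sets \<open>X \<union> S B\<close> and \<open>Y\<close>
  are still disjoint if \<open>B\<close> misses \<open>Y\<close>, so \<open>IH\<close> bounds the
  new covariances. At most \<open>card X * card Y * \<Delta>\<close> edges meet both sets, and each
  drift is at most twice the number of edges meeting the set.\<close>

lemma abs_cov_Suc_le:
  fixes W :: real
  assumes i: "i < card E" and W: "0 \<le> W"
    and IH: "\<And>X Y f g. X \<subseteq> V \<Longrightarrow> Y \<subseteq> V \<Longrightarrow> X \<inter> Y = {} \<Longrightarrow> local_on X f \<Longrightarrow> local_on Y g \<Longrightarrow>
      (\<And>U. \<bar>f U\<bar> \<le> 1) \<Longrightarrow> (\<And>U. \<bar>g U\<bar> \<le> 1) \<Longrightarrow> \<bar>cov i f g\<bar> \<le> real (card X) * real (card Y) * W"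
    and XY: "X \<subseteq> V" "Y \<subseteq> V" "X \<inter> Y = {}" "local_on X f" "local_on Y g"
    and bnd: "\<And>U. \<bar>f U\<bar> \<le> 1" "\<And>U. \<bar>g U\<bar> \<le> 1"
    and few: "(real (card X) + real (card Y)) * N \<le> card E - i"
  defines "a \<equiv> 1 / real (card E - i)"
  shows "\<bar>cov (Suc i) f g\<bar>
    \<le> real (card X) * real (card Y) * ((1 + 2 * a * D * N) * W + 6 * a * \<Delta> + 4 * a\<^sup>2 * (real N)\<^sup>2)"
proof -
  define M where "M Z = {B \<in> E. S B \<inter> Z \<noteq> {}}" for Z
  define \<delta> where "\<delta> h B = mean i (\<lambda>U. h (hit B U)) - mean i h" for h B
  define x y p q r where "x = real (card X)" and "y = real (card Y)"
    and "p = real (card (M X - M Y))" and "q = real (card (M Y - M X))" and "r = real (card (M X \<inter> M Y))"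
  have a: "0 < a"
    using i by (simp add: a_def)
  have fin: "finite (M Z)" for Z
    using finite_E by (simp add: M_def)
  have finV: "finite X" "finite Y"
    using XY finite_V by (auto intro: finite_subset)
  have cX: "real (card (M X)) \<le> x * N"
    using card_meeting_le[OF XY(1)] unfolding M_def x_def by (metis of_nat_le_iff of_nat_mult)
  have cY: "real (card (M Y)) \<le> y * N"
    using card_meeting_le[OF XY(2)] unfolding M_def y_def by (metis of_nat_le_iff of_nat_mult)
  have p: "p \<le> x * N"
    using cX card_mono[OF fin, of "M X - M Y" X] by (simp add: p_def)
  have q: "q \<le> y * N"
    using cY card_mono[OF fin, of "M Y - M X" Y] by (simp add: q_def)
  have "M X \<inter> M Y = {B \<in> E. S B \<inter> X \<noteq> {} \<and> S B \<inter> Y \<noteq> {}}"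
    by (auto simp: M_def)
  then have r: "r \<le> x * y * \<Delta>"
    using card_meeting_both_le[OF XY(1-3)] unfolding r_def x_def y_def by (metis of_nat_le_iff of_nat_mult)
  have bnd': "\<bar>f U * g U\<bar> \<le> 1" for U
    using bnd[of U] by (simp add: abs_mult mult_le_one)
  have \<delta>: "\<bar>\<delta> h B\<bar> \<le> 2" if "\<And>U. \<bar>h U\<bar> \<le> 1" for h B
    using abs_mean_le[of h 1 i] abs_mean_le[of "\<lambda>U. h (hit B U)" 1 i] that by (simp add: \<delta>_def)
  have m: "\<bar>mean i f\<bar> \<le> 1" "\<bar>mean i g\<bar> \<le> 1"
    using bnd by (auto intro: abs_mean_le)
  \<comment> \<open>This sign, guaranteed by \<open>few\<close>, allows the loss
    \<open>a * (p + q)\<close> to be used when absolute values are taken.\<close>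
  have pq: "0 \<le> 1 - a * (p + q)"
  proof -
    have "p + q \<le> (x + y) * N"
      using p q by (simp add: algebra_simps)
    also have "\<dots> \<le> real (card E - i)"
      using few i by (simp add: x_def y_def)
    finally show ?thesis
      using i by (simp add: a_def)
  qed
  \<comment> \<open>One of the \<open>D + 1\<close> vertices of \<open>S B\<close> already lies in
    \<open>Z\<close>.\<close>
  have card_Un: "card (Z \<union> S B) \<le> card Z + D" if "B \<in> M Z" "finite Z" for B Z
  proof -
    obtain z where z: "z \<in> S B" "z \<in> Z"
      using \<open>B \<in> M Z\<close> by (auto simp: M_def)
    then have "Z \<union> S B = Z \<union> (S B - {z})"
      by auto
    then have "card (Z \<union> S B) \<le> card Z + card (S B - {z})"
      by (metis card_Un_le)
    then show ?thesis
      using that z card_S[of B] by (simp add: M_def)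
  qed
  have T0: "\<bar>(1 - a * (p + q)) * cov i f g\<bar> \<le> (1 - a * (p + q)) * (x * y * W)"
    using IH[OF XY bnd] pq by (simp add: abs_mult x_def y_def mult_left_mono)
  have TP: "\<bar>\<Sum>B\<in>M X - M Y. cov i (\<lambda>U. f (hit B U)) g\<bar> \<le> p * ((x + D) * y * W)"
  proof -
    have "\<bar>cov i (\<lambda>U. f (hit B U)) g\<bar> \<le> (x + D) * y * W" if B: "B \<in> M X - M Y" for B
    proof -
      have "\<bar>cov i (\<lambda>U. f (hit B U)) g\<bar> \<le> real (card (X \<union> S B)) * real (card Y) * W"
      proof (rule IH)
        show "X \<union> S B \<subseteq> V" "(X \<union> S B) \<inter> Y = {}"
          using B XY S_subset by (auto simp: M_def)
      qed (use XY bnd local_on_hit in auto)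
      also have "\<dots> \<le> (x + D) * y * W"
      proof -
        have "card (X \<union> S B) \<le> card X + D"
          using B finV by (intro card_Un) auto
        then have "real (card (X \<union> S B)) \<le> x + D"
          unfolding x_def by linarith
        then show ?thesis
          using W unfolding y_def by (intro mult_right_mono) auto
      qed
      finally show ?thesis .
    qed
    then have "(\<Sum>B\<in>M X - M Y. \<bar>cov i (\<lambda>U. f (hit B U)) g\<bar>) \<le> p * ((x + D) * y * W)"
      unfolding p_def by (rule sum_bounded_above)
    then show ?thesis
      by (rule order_trans[OF sum_abs])
  qed
  have TQ: "\<bar>\<Sum>B\<in>M Y - M X. cov i f (\<lambda>U. g (hit B U))\<bar> \<le> q * (x * (y + D) * W)"
  proof -
    have "\<bar>cov i f (\<lambda>U. g (hit B U))\<bar> \<le> x * (y + D) * W" if B: "B \<in> M Y - M X" for B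
    proof -
      have "\<bar>cov i f (\<lambda>U. g (hit B U))\<bar> \<le> real (card X) * real (card (Y \<union> S B)) * W"
      proof (rule IH)
        show "Y \<union> S B \<subseteq> V" "X \<inter> (Y \<union> S B) = {}"
          using B XY S_subset by (auto simp: M_def)
      qed (use XY bnd local_on_hit in auto)
      also have "\<dots> \<le> x * (y + D) * W"
      proof -
        have "card (Y \<union> S B) \<le> card Y + D"
          using B finV by (intro card_Un) auto
        then have "real (card (Y \<union> S B)) \<le> y + D"
          unfolding y_def by linarith
        then show ?thesis
          using W unfolding x_def by (intro mult_right_mono mult_left_mono) auto
      qed
      finally show ?thesis .
    qed
    then have "(\<Sum>B\<in>M Y - M X. \<bar>cov i f (\<lambda>U. g (hit B U))\<bar>) \<le> q * (x * (y + D) * W)"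
      unfolding q_def by (rule sum_bounded_above)
    then show ?thesis
      by (rule order_trans[OF sum_abs])
  qed
  have TR: "\<bar>\<Sum>B\<in>M X \<inter> M Y. \<delta> (\<lambda>U. f U * g U) B - \<delta> f B * mean i g - mean i f * \<delta> g B\<bar> \<le> r * 6"
  proof -
    \<comment> \<open>Three terms of at most 2 each, as increments are at most 2 and means at most
      1.\<close>
    have "\<bar>\<delta> (\<lambda>U. f U * g U) B - \<delta> f B * mean i g - mean i f * \<delta> g B\<bar> \<le> 6" for B
    proof -
      have "\<bar>\<delta> f B * mean i g\<bar> \<le> 2 * 1" "\<bar>mean i f * \<delta> g B\<bar> \<le> 1 * 2"
        unfolding abs_mult using \<delta>[of f B, OF bnd(1)] \<delta>[of g B, OF bnd(2)] m by (intro mult_mono; simp)+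
      then show ?thesis
        using \<delta>[of "\<lambda>U. f U * g U" B, OF bnd'] by linarith
    qed
    then have "(\<Sum>B\<in>M X \<inter> M Y. \<bar>\<delta> (\<lambda>U. f U * g U) B - \<delta> f B * mean i g - mean i f * \<delta> g B\<bar>)
        \<le> r * 6"
      unfolding r_def by (intro sum_bounded_above) auto
    then show ?thesis
      by (rule order_trans[OF sum_abs])
  qed
  have TS: "\<bar>(\<Sum>B\<in>M X. \<delta> f B) * (\<Sum>B\<in>M Y. \<delta> g B)\<bar> \<le> (2 * (x * N)) * (2 * (y * N))"
  proof -
    have "\<bar>\<Sum>B\<in>M Z. \<delta> h B\<bar> \<le> real (card (M Z)) * 2" if "\<And>U. \<bar>h U\<bar> \<le> 1" for h Z
      using \<delta>[of h, OF that] by (intro order_trans[OF sum_abs] sum_bounded_above) auto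
    from this[of f X, OF bnd(1)] this[of g Y, OF bnd(2)] show ?thesis
      unfolding abs_mult using cX cY by (intro mult_mono) auto
  qed
  have "cov (Suc i) f g = (1 - a * (p + q)) * cov i f g
      + a * (\<Sum>B\<in>M X - M Y. cov i (\<lambda>U. f (hit B U)) g)
      + a * (\<Sum>B\<in>M Y - M X. cov i f (\<lambda>U. g (hit B U)))
      + a * (\<Sum>B\<in>M X \<inter> M Y. \<delta> (\<lambda>U. f U * g U) B - \<delta> f B * mean i g - mean i f * \<delta> g B)
      - a\<^sup>2 * ((\<Sum>B\<in>M X. \<delta> f B) * (\<Sum>B\<in>M Y. \<delta> g B))"
    unfolding cov_Suc[OF i XY(4,5)] a_def p_def q_def M_def \<delta>_def by (simp add: mult.assoc)
  also have "\<bar>\<dots>\<bar> \<le> (1 - a * (p + q)) * (x * y * W) + a * (p * ((x + D) * y * W))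
      + a * (q * (x * (y + D) * W)) + a * (r * 6) + a\<^sup>2 * ((2 * (x * N)) * (2 * (y * N)))"
  proof -
    have abs5: "\<bar>u1 + a * u2 + a * u3 + a * u4 - a\<^sup>2 * u5\<bar> \<le> b1 + a * b2 + a * b3 + a * b4 + a\<^sup>2 * b5"
      if "\<bar>u1\<bar> \<le> b1" "\<bar>u2\<bar> \<le> b2" "\<bar>u3\<bar> \<le> b3" "\<bar>u4\<bar> \<le> b4" "\<bar>u5\<bar> \<le> b5" for u1 u2 u3 u4 u5 b1 b2 b3 b4 b5
    proof -
      have "\<bar>a * u2\<bar> \<le> a * b2" "\<bar>a * u3\<bar> \<le> a * b3" "\<bar>a * u4\<bar> \<le> a * b4" "\<bar>a\<^sup>2 * u5\<bar> \<le> a\<^sup>2 * b5"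
        using that a by (simp_all add: abs_mult)
      with that(1) show ?thesis
        by linarith
    qed
    show ?thesis
      by (rule abs5[OF T0 TP TQ TR TS])
  qed
  \<comment> \<open>The multiples \<open>a * p * x * y * W\<close> and
    \<open>a * q * x * y * W\<close> cancel. Only the enlargement by \<open>D\<close> contributes to
    the growth.\<close>
  also have "\<dots> = x * y * W + a * D * W * (p * y + q * x) + 6 * a * r + 4 * a\<^sup>2 * (real N)\<^sup>2 * (x * y)"
    by (simp add: algebra_simps power2_eq_square)
  also have "\<dots> \<le> x * y * W + a * D * W * (x * N * y + y * N * x) + 6 * a * (x * y * \<Delta>)
      + 4 * a\<^sup>2 * (real N)\<^sup>2 * (x * y)"
    using a W p q r by (intro add_mono mult_left_mono mult_right_mono order_refl)
      (auto simp: x_def y_def)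
  also have "\<dots> = x * y * ((1 + 2 * a * D * N) * W + 6 * a * \<Delta> + 4 * a\<^sup>2 * (real N)\<^sup>2)"
    by (simp add: algebra_simps)
  finally show ?thesis
    by (simp add: x_def y_def)
qed

text \<open>
  The bound of \<open>abs_cov_Suc_le\<close> iterated for \<open>a \<le> 2 / card E\<close>. The initial value \<open>8 q\<close>, although
  the covariance vanishes initially, covers sets \<open>X\<close> and \<open>Y\<close> too large for that lemma: there it
  makes the bound exceed the trivial bound \<open>2\<close>.
\<close>

definition cov_bound :: "nat \<Rightarrow> real" where
  "cov_bound i = (let q = N / card E in
     (1 + 4 * D * q) ^ i * (8 * q + i * (12 * \<Delta> / card E + 16 * q\<^sup>2)))"

lemma cov_bound_nonneg: "0 \<le> cov_bound i"
  by (simp add: cov_bound_def Let_def)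

lemma cov_bound_ge: "8 * N / card E \<le> cov_bound i"
proof -
  have "1 * (8 * N / card E) \<le> cov_bound i"
    unfolding cov_bound_def Let_def by (intro mult_mono one_le_power) auto
  then show ?thesis
    by simp
qed

text \<open>The closed form multiplies also the newest error by a power of the growth factor; this
  only increases it, since the factor is at least 1.\<close>

lemma cov_bound_Suc:
  "(1 + 4 * D * (N / card E)) * cov_bound i + 12 * \<Delta> / card E + 16 * (N / card E)\<^sup>2 \<le> cov_bound (Suc i)"
proof -
  define z b where "z = 1 + 4 * D * (N / card E)" and "b = 12 * \<Delta> / card E + 16 * (N / card E)\<^sup>2"
  have "1 * b \<le> z ^ Suc i * b"
    by (intro mult_right_mono one_le_power) (auto simp: z_def b_def)
  moreover have cb: "cov_bound m = z ^ m * (8 * (N / card E) + m * b)" for m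
    by (simp add: cov_bound_def Let_def z_def b_def)
  have "cov_bound (Suc i) = z * cov_bound i + z ^ Suc i * b"
    unfolding cb by (simp add: algebra_simps)
  ultimately show ?thesis
    by (simp add: z_def b_def)
qed

text \<open>The induction treats all sets and functions at once, since each step applies the
  hypothesis to enlarged sets and to functions composed with \<open>hit B\<close>. In the first half
  of the ordering \<open>1 / (card E - i)\<close> is at most \<open>2 / card E\<close>.\<close>

lemma abs_cov_bound:
  assumes "2 * i \<le> card E"
    and "X \<subseteq> V" "Y \<subseteq> V" "X \<inter> Y = {}" "local_on X f" "local_on Y g"
    and "\<And>U. \<bar>f U\<bar> \<le> 1" "\<And>U. \<bar>g U\<bar> \<le> 1"
  shows "\<bar>cov i f g\<bar> \<le> real (card X) * real (card Y) * cov_bound i"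
  using assms
proof (induction i arbitrary: X Y f g)
  case 0
  then show ?case
    using cov_bound_nonneg[of 0] by (simp add: cov_def mean_0)
next
  case (Suc i)
  define n a where "n = real (card E)" and "a = 1 / real (card E - i)"
  have i2: "2 * i + 2 \<le> card E"
    using Suc.prems(1) by simp
  then have i: "i < card E"
    by linarith
  have n: "0 < n" "n / 2 \<le> real (card E - i)"
  proof -
    show "0 < n"
      using i by (simp add: n_def)
    have "card E \<le> 2 * (card E - i)"
      using i2 by linarith
    then show "n / 2 \<le> real (card E - i)"
      unfolding n_def by linarith
  qed
  then have a: "0 < a" "a \<le> 2 / n"
    by (simp_all add: a_def field_simps)
  have fin: "finite X" "finite Y"
    using Suc.prems finite_V by (auto intro: finite_subset)
  consider "X = {} \<or> Y = {}" | "X \<noteq> {}" "Y \<noteq> {}" "(real (card X) + real (card Y)) * N \<le> card E - i"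
    | "X \<noteq> {}" "Y \<noteq> {}" "(real (card X) + real (card Y)) * N > card E - i"
    by force
  then show ?case
  proof cases
    \<comment> \<open>The claimed bound is 0 here. A function depending on no vertex is constant, so
      the covariance indeed vanishes.\<close>
    case 1
    have "h = (\<lambda>_. h {})" if "local_on {} h" for h
      using that by (auto simp: local_on_def)
    with 1 Suc.prems(5,6) consider c where "f = (\<lambda>_. c)" | c where "g = (\<lambda>_. c)"
      by metis
    then have "cov (Suc i) f g = 0"
      by cases (simp_all add: cov_def mean_const mean_cmult mult.commute[of _ c for c])
    then show ?thesis
      using cov_bound_nonneg by simp
  next
    case 2
    have "\<bar>cov (Suc i) f g\<bar> \<le> real (card X) * real (card Y)
        * ((1 + 2 * a * D * N) * cov_bound i + 6 * a * \<Delta> + 4 * a\<^sup>2 * (real N)\<^sup>2)"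
      unfolding a_def
    proof (rule abs_cov_Suc_le[OF i cov_bound_nonneg Suc.IH])
    qed (use Suc.prems 2 in auto)
    also have "\<dots> \<le> real (card X) * real (card Y) * cov_bound (Suc i)"
    proof (rule mult_left_mono)
      have "(1 + 2 * a * D * N) * cov_bound i + 6 * a * \<Delta> + 4 * a\<^sup>2 * (real N)\<^sup>2
          \<le> (1 + 2 * (2 / n) * D * N) * cov_bound i + 6 * (2 / n) * \<Delta> + 4 * (2 / n)\<^sup>2 * (real N)\<^sup>2"
        using a cov_bound_nonneg[of i] by (intro add_mono mult_right_mono mult_left_mono power_mono) auto
      also have "\<dots> = (1 + 4 * D * (N / n)) * cov_bound i + 12 * \<Delta> / n + 16 * (N / n)\<^sup>2"
        by (simp add: power_divide field_simps)
      also have "\<dots> \<le> cov_bound (Suc i)"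
        using cov_bound_Suc[of i] by (simp add: n_def)
      finally show "(1 + 2 * a * D * N) * cov_bound i + 6 * a * \<Delta> + 4 * a\<^sup>2 * (real N)\<^sup>2 \<le> cov_bound (Suc i)" .
    qed simp
    finally show ?thesis .
  next
    case 3
    let ?x = "real (card X)" and ?y = "real (card Y)"
    have xy: "1 \<le> ?x" "1 \<le> ?y"
      using 3 fin by (simp_all add: Suc_le_eq card_gt_0_iff)
    \<comment> \<open>This gives \<open>?x + ?y \<le> 2 * (?x * ?y)\<close>, and since the size
      condition fails, \<open>?x * ?y * (8 * N / card E)\<close> is at least 2.\<close>
    then have "0 \<le> (?x - 1) * (?y - 1)"
      by simp
    moreover have "1 \<le> ?x * ?y"
      using xy by (metis mult_mono' mult_1 zero_le_one)
    ultimately have "?x + ?y \<le> 2 * (?x * ?y)"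
      by (simp add: algebra_simps)
    then have "(?x + ?y) * N \<le> 2 * (?x * ?y) * N"
      by (rule mult_right_mono) simp
    with 3(3) n(2) have "n \<le> 4 * (?x * ?y) * N"
      by linarith
    then have "2 \<le> ?x * ?y * (8 * N / card E)"
      using n(1) by (simp add: n_def field_simps)
    also have "\<dots> \<le> ?x * ?y * cov_bound (Suc i)"
      by (intro mult_left_mono cov_bound_ge) simp
    finally show ?thesis
      using abs_cov_le[of f g "Suc i", OF Suc.prems(7,8)] by linarith
  qed
qed

section \<open>Symmetry and decay of the uncovered probability\<close>

lemma residual_subset: "residual xs \<subseteq> V"
  using residual_append_subset[of "[]" xs] by simp

lemma hit_image:
  assumes "bij_betw p V V" and "U \<subseteq> V" and "S B \<subseteq> V" and "S B' = p ` S B"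
  shows "hit B' (p ` U) = p ` hit B U"
proof -
  have inj: "inj_on p V"
    using assms(1) by (simp add: bij_betw_def)
  show ?thesis
    unfolding hit_def assms(4) inj_on_image_subset_iff[OF inj assms(3,2)]
    using inj_on_image_set_diff[OF inj _ assms(3), of U] assms(2) by auto
qed

lemma residual_map:
  assumes p: "bij_betw p V V" and S: "\<forall>B\<in>E. S (\<sigma> B) = p ` S B" and "set xs \<subseteq> E"
  shows "residual (map \<sigma> xs) = p ` residual xs"
  using assms(3)
proof (induction xs rule: rev_induct)
  case Nil
  then show ?case
    using p by (simp add: bij_betw_def)
next
  case (snoc B xs)
  then show ?case
    using hit_image[OF p residual_subset[of xs] S_subset, of B "\<sigma> B"] S
    by (simp add: residual_snoc)
qed

text \<open>An automorphism taking \<open>x\<close> to \<open>y\<close> permutes the orderings and,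
  by \<open>residual_map\<close>, carries each residual set to that of the relabelled
  ordering.\<close>

lemma mean_mem_eq:
  assumes "x \<in> V" and "y \<in> V"
  shows "mean i (\<lambda>U. of_bool (x \<in> U)) = mean i (\<lambda>U. of_bool (y \<in> U))"
proof -
  obtain \<sigma> p where \<sigma>: "bij_betw \<sigma> E E" and p: "bij_betw p V V" "p x = y"
    and S: "\<forall>B\<in>E. S (\<sigma> B) = p ` S B"
    using transitive[OF assms] by blast
  let ?P = "permutations_of_set E"
  have perm: "set \<omega> = E" if "\<omega> \<in> ?P" for \<omega>
    using that by (simp add: permutations_of_set_def)
  have "?P = map \<sigma> ` ?P"
    using permutations_of_set_image_inj[of \<sigma> E] \<sigma> by (simp add: bij_betw_def)
  moreover have "inj_on (map \<sigma>) ?P"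
    using \<sigma> perm by (intro inj_onI) (auto simp: bij_betw_def dest: map_inj_on)
  ultimately have "(\<Sum>\<omega>\<in>?P. of_bool (y \<in> residual (take i \<omega>)) :: real)
      = (\<Sum>\<omega>\<in>?P. of_bool (y \<in> residual (take i (map \<sigma> \<omega>))))"
    by (metis (no_types, lifting) sum.reindex_cong)
  also have "\<dots> = (\<Sum>\<omega>\<in>?P. of_bool (x \<in> residual (take i \<omega>)))"
  proof (rule sum.cong[OF refl])
    fix \<omega> assume "\<omega> \<in> ?P"
    then have "set (take i \<omega>) \<subseteq> E"
      using perm set_take_subset by fastforce
    then have "residual (take i (map \<sigma> \<omega>)) = p ` residual (take i \<omega>)"
      using residual_map[OF p(1) S] by (simp add: take_map)
    moreover have "y \<in> p ` residual (take i \<omega>) \<longleftrightarrow> x \<in> residual (take i \<omega>)"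
      unfolding p(2)[symmetric]
      by (rule inj_on_image_mem_iff[OF bij_betw_imp_inj_on[OF p(1)] assms(1) residual_subset])
    ultimately show "of_bool (y \<in> residual (take i (map \<sigma> \<omega>))) = of_bool (x \<in> residual (take i \<omega>))"
      by simp
  qed
  finally show ?thesis
    by (simp add: mean_def)
qed

lemma mean_mem_antimono:
  assumes "i \<le> j"
  shows "mean j (\<lambda>U. of_bool (x \<in> U)) \<le> mean i (\<lambda>U. of_bool (x \<in> U))"
  unfolding mean_def
proof (intro divide_right_mono sum_mono)
  fix \<omega> :: "'e list"
  have "take j \<omega> = take i \<omega> @ drop i (take j \<omega>)"
    using assms by (metis append_take_drop_id min_def take_take)
  then have "residual (take j \<omega>) \<subseteq> residual (take i \<omega>)"
    by (metis residual_append_subset)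
  then show "of_bool (x \<in> residual (take j \<omega>)) \<le> (of_bool (x \<in> residual (take i \<omega>)) :: real)"
    by auto
qed auto

lemma mean_of_bool_nonneg: "0 \<le> mean i (\<lambda>U. of_bool (Q U))"
  and mean_of_bool_le_1: "mean i (\<lambda>U. of_bool (Q U)) \<le> 1"
  using abs_mean_le[of "\<lambda>U. of_bool (Q U)" 1 i] mean_mono[of "\<lambda>_. 0" "\<lambda>U. of_bool (Q U)" i]
  by (auto simp: mean_const)

text \<open>Vertices are added one at a time. Being uncovered is nearly independent of the
  \<open>m\<close> previous vertices, at the cost \<open>m * cov_bound i\<close>, and earlier errors
  are multiplied by a probability, so the errors add up to at most a square.\<close>

lemma mean_subset_approx:
  assumes "2 * i \<le> card E" and "x \<in> V" and "A \<subseteq> V"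
  shows "\<bar>mean i (\<lambda>U. of_bool (A \<subseteq> U)) - mean i (\<lambda>U. of_bool (x \<in> U)) ^ card A\<bar>
    \<le> (real (card A))\<^sup>2 * cov_bound i"
proof -
  have "finite A"
    using assms(3) finite_V by (rule finite_subset)
  then show ?thesis
    using assms(3)
  proof (induction A rule: finite_induct)
    case empty
    then show ?case
      by (simp add: mean_const)
  next
    case (insert a A)
    define u P m where "u = mean i (\<lambda>U. of_bool (x \<in> U))" and "P = mean i (\<lambda>U. of_bool (A \<subseteq> U))"
      and "m = real (card A)"
    have u: "0 \<le> u" "u \<le> 1"
      by (simp_all add: u_def mean_of_bool_nonneg mean_of_bool_le_1)
    have a: "mean i (\<lambda>U. of_bool (a \<in> U)) = u"
      using mean_mem_eq[of a x] insert.prems assms(2) by (simp add: u_def)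
    have "\<bar>cov i (\<lambda>U. of_bool (A \<subseteq> U)) (\<lambda>U. of_bool (a \<in> U))\<bar> \<le> m * real (card {a}) * cov_bound i"
      unfolding m_def
    proof (rule abs_cov_bound[OF assms(1)])
      show "local_on A (\<lambda>U. of_bool (A \<subseteq> U))" "local_on {a} (\<lambda>U. of_bool (a \<in> U))"
        by (auto simp: local_on_def)
    qed (use insert in auto)
    moreover have "(\<lambda>U. of_bool (A \<subseteq> U) * of_bool (a \<in> U) :: real) = (\<lambda>U. of_bool (insert a A \<subseteq> U))"
      by auto
    ultimately have 1: "\<bar>mean i (\<lambda>U. of_bool (insert a A \<subseteq> U)) - P * u\<bar> \<le> m * cov_bound i"
      by (simp add: cov_def P_def a)
    have "\<bar>P - u ^ card A\<bar> \<le> m\<^sup>2 * cov_bound i"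
      using insert by (simp add: P_def u_def m_def)
    then have "\<bar>P - u ^ card A\<bar> * u \<le> m\<^sup>2 * cov_bound i * 1"
      using u cov_bound_nonneg[of i] by (intro mult_mono) auto
    moreover have "P * u - u ^ card (insert a A) = (P - u ^ card A) * u"
      using insert.hyps by (simp add: algebra_simps)
    ultimately have "\<bar>P * u - u ^ card (insert a A)\<bar> \<le> m\<^sup>2 * cov_bound i"
      by (simp only: abs_mult abs_of_nonneg[OF u(1)] mult_1_right)
    with 1 have "\<bar>mean i (\<lambda>U. of_bool (insert a A \<subseteq> U)) - u ^ card (insert a A)\<bar>
        \<le> (m + m\<^sup>2) * cov_bound i"
      by (simp add: algebra_simps)
    also have "\<dots> \<le> (real (card (insert a A)))\<^sup>2 * cov_bound i"
      using insert.hyps cov_bound_nonneg[of i]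
      by (intro mult_right_mono) (auto simp: m_def power2_eq_square algebra_simps)
    finally show ?case
      by (simp add: u_def)
  qed
qed

text \<open>The vertex \<open>x\<close> is lost when the scanned edge contains it and is entirely
  uncovered. Each of the \<open>N\<close> edges through \<open>x\<close> is uncovered with
  probability about \<open>u i ^ Suc D\<close>, by \<open>mean_subset_approx\<close>.\<close>

lemma mean_mem_Suc_le:
  assumes "2 * i \<le> card E" and i: "i < card E" and x: "x \<in> V"
  defines "u \<equiv> \<lambda>i. mean i (\<lambda>U. of_bool (x \<in> U))"
  shows "u (Suc i) \<le> u i - N / card E * (u i ^ Suc D - (real (Suc D))\<^sup>2 * cov_bound i)"
proof -
  let ?M = "{B \<in> E. x \<in> S B}"
  define w where "w = u i ^ Suc D - (real (Suc D))\<^sup>2 * cov_bound i"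
  define P where "P = (\<Sum>B\<in>?M. mean i (\<lambda>U. of_bool (S B \<subseteq> U)))"
  have "mean i (\<lambda>U. of_bool (x \<in> hit B U)) - u i = - of_bool (B \<in> ?M) * mean i (\<lambda>U. of_bool (S B \<subseteq> U))"
    if "B \<in> E" for B
  proof -
    have "of_bool (x \<in> hit B U) - of_bool (x \<in> U) = - of_bool (B \<in> ?M) * (of_bool (S B \<subseteq> U) :: real)" for U
      using that by (auto simp: hit_def)
    then show ?thesis
      unfolding u_def by (subst mean_diff[symmetric], subst mean_cmult[symmetric]) simp
  qed
  then have "(\<Sum>B\<in>E. mean i (\<lambda>U. of_bool (x \<in> hit B U)) - u i)
      = (\<Sum>B\<in>E. - of_bool (B \<in> ?M) * mean i (\<lambda>U. of_bool (S B \<subseteq> U)))"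
    by (intro sum.cong) auto
  also have "\<dots> = - P"
    unfolding P_def sum_negf[symmetric] using finite_E by (intro sum.mono_neutral_cong_right) auto
  finally have eq: "u (Suc i) = u i - P / real (card E - i)"
    using mean_Suc[OF i, of "\<lambda>U. of_bool (x \<in> U)"] by (simp add: u_def)
  have P0: "0 \<le> P"
    unfolding P_def by (intro sum_nonneg mean_of_bool_nonneg)
  have "w \<le> mean i (\<lambda>U. of_bool (S B \<subseteq> U))" if "B \<in> ?M" for B
    using mean_subset_approx[OF assms(1) x S_subset, of B] that card_S[of B] unfolding w_def u_def
    by (simp add: abs_le_iff del: power_Suc)
  then have "real (card ?M) * w \<le> P"
    unfolding P_def by (rule sum_bounded_below)
  then have "N * w \<le> P"
    using degree[OF x] by simp
  then have "N * w / card E \<le> P / card E"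
    by (rule divide_right_mono) simp
  \<comment> \<open>The denominator is changed at \<open>P\<close>, which is nonnegative, while
    \<open>w\<close> may be negative.\<close>
  also have "\<dots> \<le> P / real (card E - i)"
    using P0 i by (intro divide_left_mono) auto
  finally show ?thesis
    using eq by (simp add: w_def)
qed

lemma cov_bound_mono:
  assumes "i \<le> j"
  shows "cov_bound i \<le> cov_bound j"
proof (rule lift_Suc_mono_le[OF _ assms])
  fix m
  have "1 * cov_bound m \<le> (1 + 4 * D * (N / card E)) * cov_bound m"
    using cov_bound_nonneg by (intro mult_right_mono) auto
  moreover have "0 \<le> 12 * \<Delta> / card E + 16 * (N / card E)\<^sup>2"
    by simp
  ultimately show "cov_bound m \<le> cov_bound (Suc m)"
    using cov_bound_Suc[of m] by linarith
qed

text \<open>If the first alternative fails, the error is below half of the main term at time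
  \<open>m\<close>, hence at all earlier times, as \<open>u\<close> decreases and
  \<open>cov_bound\<close> increases. What remains is a discrete form of
  \<open>u' = - u ^ Suc D / 2\<close> in the time \<open>q * i\<close>, solved by
  \<open>(1 + D * q * i / 2) * u ^ D = 1\<close>.\<close>

lemma mean_mem_bound:
  assumes "2 * m \<le> card E" and x: "x \<in> V"
  defines "u \<equiv> \<lambda>i. mean i (\<lambda>U. of_bool (x \<in> U))"
  shows "u m ^ Suc D \<le> 2 * (real (Suc D))\<^sup>2 * cov_bound m \<or> D * (N / card E) * m * u m ^ D \<le> 2"
proof (rule disjCI)
  assume "\<not> D * (N / card E) * m * u m ^ D \<le> 2"
  show "u m ^ Suc D \<le> 2 * (real (Suc D))\<^sup>2 * cov_bound m"
  proof (rule ccontr)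
    assume *: "\<not> u m ^ Suc D \<le> 2 * (real (Suc D))\<^sup>2 * cov_bound m"
    define q where "q = N / card E"
    have q: "0 \<le> q"
      by (simp add: q_def)
    have u0: "0 \<le> u i" for i
      by (simp add: u_def mean_of_bool_nonneg)
    have "(1 + D * q * i / 2) * u i ^ D \<le> 1" if "i \<le> m" for i
      using that
    proof (induction i)
      case 0
      then show ?case
        using x by (simp add: u_def mean_0)
    next
      case (Suc i)
      define z where "z = q / 2 * u i ^ D"
      have "2 * ((real (Suc D))\<^sup>2 * cov_bound i) \<le> 2 * ((real (Suc D))\<^sup>2 * cov_bound m)"
        using Suc.prems by (intro mult_left_mono cov_bound_mono) auto
      also have "\<dots> < u m ^ Suc D"
        using * by (simp add: mult.assoc)
      also have "\<dots> \<le> u i ^ Suc D"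
        using Suc.prems u0 by (intro power_mono) (auto simp: u_def intro!: mean_mem_antimono)
      finally have large: "u i ^ Suc D / 2 \<le> u i ^ Suc D - (real (Suc D))\<^sup>2 * cov_bound i"
        and pos: "0 < u i ^ Suc D"
        using cov_bound_nonneg[of i] by (auto intro: le_less_trans[rotated])
      have "u (Suc i) \<le> u i - q * (u i ^ Suc D - (real (Suc D))\<^sup>2 * cov_bound i)"
        unfolding u_def q_def using Suc.prems assms(1) by (intro mean_mem_Suc_le x) auto
      also have "\<dots> \<le> u i - q * (u i ^ Suc D / 2)"
        using large q by (intro diff_mono mult_left_mono) auto
      also have "\<dots> = u i * (1 - z)"
        by (simp add: z_def algebra_simps)
      finally have le: "u (Suc i) \<le> u i * (1 - z)" .
      have "0 < u i"
        using pos u0[of i] by (metis less_eq_real_def power_0_Suc less_irrefl)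
      \<comment> \<open>The step cannot overshoot: the next value is nonnegative, which forces
        \<open>z \<le> 1\<close>.\<close>
      moreover have "0 \<le> u i * (1 - z)"
        using le u0[of "Suc i"] by linarith
      ultimately have z: "0 \<le> z" "z \<le> 1"
        using q u0[of i] by (auto simp: z_def zero_le_mult_iff)
      have "(1 + D * q * Suc i / 2) * u (Suc i) ^ D \<le> (1 + D * q * Suc i / 2) * (u i * (1 - z)) ^ D"
        using q le u0 by (intro mult_left_mono power_mono) auto
      also have "\<dots> = ((1 + D * q * i / 2) * u i ^ D + D * z) * (1 - z) ^ D"
      proof -
        have "(1 + D * q * Suc i / 2) * u i ^ D = (1 + D * q * i / 2) * u i ^ D + D * z"
          by (simp add: z_def algebra_simps add_divide_distrib)
        then show ?thesis
          by (simp only: power_mult_distrib flip: mult.assoc)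
      qed
      also have "\<dots> \<le> (1 + D * z) * (1 - z) ^ D"
        using Suc z by (intro mult_right_mono add_right_mono) auto
      also have "\<dots> \<le> 1"
        using z by (rule one_plus_mult_power_le_1)
      finally show ?case .
    qed
    from this[of m] have "D * q * m / 2 * u m ^ D + u m ^ D \<le> 1"
      by (simp add: algebra_simps)
    moreover have "0 \<le> u m ^ D"
      using u0 by simp
    ultimately have "D * q * m * u m ^ D \<le> 2"
      by simp
    with \<open>\<not> D * (N / card E) * m * u m ^ D \<le> 2\<close> show False
      by (simp add: q_def)
  qed
qed

end

subsection \<open>The hypergraph of blocks\<close>

lemma sum_of_bool_filter:
  assumes "finite A"
  shows "(\<Sum>x\<in>A. of_bool (P x)) = card {x \<in> A. P x}"
proof -
  have "{x \<in> A. P x} = A \<inter> {x. P x}"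
    by blast
  then show ?thesis
    using assms by (simp add: sum_of_bool_eq)
qed

lemma card_nsets_superset:
  assumes "finite X" and "A \<subseteq> X" and "card A \<le> k"
  shows "card {B \<in> nsets X k. A \<subseteq> B} = (card X - card A) choose (k - card A)"
proof -
  have A: "finite A"
    using assms finite_subset by blast
  have "bij_betw (\<lambda>C. C \<union> A) (nsets (X - A) (k - card A)) {B \<in> nsets X k. A \<subseteq> B}"
  proof (rule bij_betw_byWitness[where f' = "\<lambda>B. B - A"])
    show "\<forall>C\<in>nsets (X - A) (k - card A). C \<union> A - A = C"
      by (auto simp: nsets_def)
    show "\<forall>B\<in>{B \<in> nsets X k. A \<subseteq> B}. B - A \<union> A = B"
      by auto
    show "(\<lambda>C. C \<union> A) ` nsets (X - A) (k - card A) \<subseteq> {B \<in> nsets X k. A \<subseteq> B}"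
    proof safe
      fix C assume C: "C \<in> nsets (X - A) (k - card A)"
      then have "card (C \<union> A) = k"
        using A assms(3) by (subst card_Un_disjoint) (auto simp: nsets_def)
      then show "C \<union> A \<in> nsets X k"
        using C A assms(2) by (auto simp: nsets_def)
    qed
    show "(\<lambda>B. B - A) ` {B \<in> nsets X k. A \<subseteq> B} \<subseteq> nsets (X - A) (k - card A)"
      using A by (auto simp: nsets_def card_Diff_subset)
  qed
  then show ?thesis
    using A assms by (simp add: bij_betw_same_card[symmetric] card_Diff_subset)
qed

lemma transitive_nsets:
  assumes "finite X" and "T \<in> nsets X t" and "T' \<in> nsets X t"
  shows "\<exists>\<pi>. bij_betw \<pi> X X \<and> \<pi> ` T = T'"
proof -
  have T: "T \<subseteq> X" "finite T" "card T = t" "T' \<subseteq> X" "finite T'" "card T' = t"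
    using assms by (auto simp: nsets_def)
  obtain f where f: "bij_betw f T T'"
    using finite_same_card_bij[of T T'] T by auto
  obtain g where g: "bij_betw g (X - T) (X - T')"
    using finite_same_card_bij[of "X - T" "X - T'"] T assms(1) by (auto simp: card_Diff_subset)
  define \<pi> where "\<pi> x = (if x \<in> T then f x else g x)" for x
  have "bij_betw \<pi> (T \<union> (X - T)) (T' \<union> (X - T'))"
    unfolding \<pi>_def using f g by (rule bij_betw_disjoint_Un) auto
  moreover have "T \<union> (X - T) = X" "T' \<union> (X - T') = X"
    using T by auto
  moreover have "\<pi> ` T = T'"
    using f by (auto simp: \<pi>_def bij_betw_def)
  ultimately show ?thesis
    by metis
qed

text \<open>The degree counts the blocks through \<open>t\<close> given points, the codegree bound
  those through \<open>t + 1\<close>. Automorphisms come from permutations of the points.\<close>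

lemma transitive_hypergraph_nsets:
  assumes "t < k" and "k \<le> v"
  shows "transitive_hypergraph (nsets {..<v} k) (nsets {..<v} t) (\<lambda>B. nsets B t)
    ((k choose t) - 1) ((v - t) choose (k - t)) ((v - Suc t) choose (k - Suc t))"
proof
  show "finite (nsets {..<v} k)" "finite (nsets {..<v} t)"
    by (simp_all add: finite_imp_finite_nsets)
  show "nsets {..<v} k \<noteq> {}"
    using assms by (simp add: nsets_eq_empty_iff)
  fix B assume B: "B \<in> nsets {..<v} k"
  then show "nsets B t \<subseteq> nsets {..<v} t"
    by (intro nsets_mono) (auto simp: nsets_def)
  have "card B = k"
    using B by (simp add: nsets_def)
  then show "card (nsets B t) = Suc ((k choose t) - 1)"
    using assms by simp
next
  fix T assume T: "T \<in> nsets {..<v} t"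
  then have "{B \<in> nsets {..<v} k. T \<in> nsets B t} = {B \<in> nsets {..<v} k. T \<subseteq> B}"
    by (auto simp: nsets_def)
  also have "card \<dots> = (v - t) choose (k - t)"
    using card_nsets_superset[of "{..<v}" T k] T assms by (simp add: nsets_def)
  finally show "card {B \<in> nsets {..<v} k. T \<in> nsets B t} = (v - t) choose (k - t)" .
next
  fix T T' assume T: "T \<in> nsets {..<v} t" "T' \<in> nsets {..<v} t" "T \<noteq> T'"
  then have "\<not> T' \<subseteq> T"
    by (metis (mono_tags, lifting) card_subset_eq mem_Collect_eq nsets_def)
  then obtain x where x: "x \<in> T'" "x \<notin> T"
    by auto
  \<comment> \<open>Two different \<open>t\<close>-sets span at least \<open>t + 1\<close> points,
    so every block containing both contains \<open>A\<close>.\<close>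
  define A where "A = insert x T"
  have A: "A \<subseteq> {..<v}" "card A = Suc t"
    using x T by (auto simp: A_def nsets_def)
  have "{B \<in> nsets {..<v} k. T \<in> nsets B t \<and> T' \<in> nsets B t} \<subseteq> {B \<in> nsets {..<v} k. A \<subseteq> B}"
    using x by (auto simp: A_def nsets_def)
  then have "card {B \<in> nsets {..<v} k. T \<in> nsets B t \<and> T' \<in> nsets B t}
      \<le> card {B \<in> nsets {..<v} k. A \<subseteq> B}"
    by (intro card_mono) (simp_all add: finite_imp_finite_nsets)
  then show "card {B \<in> nsets {..<v} k. T \<in> nsets B t \<and> T' \<in> nsets B t}
      \<le> (v - Suc t) choose (k - Suc t)"
    using card_nsets_superset[of "{..<v}" A k] A assms by simp
next
  fix T T' assume "T \<in> nsets {..<v} t" "T' \<in> nsets {..<v} t"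
  then obtain \<pi> where \<pi>: "bij_betw \<pi> {..<v} {..<v}" "\<pi> ` T = T'"
    using transitive_nsets by blast
  have "nsets (\<pi> ` B) t = (`) \<pi> ` nsets B t" if "B \<in> nsets {..<v} k" for B
  proof -
    have "bij_betw \<pi> B (\<pi> ` B)"
      using \<pi>(1) that by (auto simp: nsets_def intro: bij_betw_subset)
    then show ?thesis
      using bij_betw_nsets by (metis bij_betw_imp_surj_on)
  qed
  then show "\<exists>\<sigma> p. bij_betw \<sigma> (nsets {..<v} k) (nsets {..<v} k)
      \<and> bij_betw p (nsets {..<v} t) (nsets {..<v} t) \<and> p T = T'
      \<and> (\<forall>B\<in>nsets {..<v} k. nsets (\<sigma> B) t = p ` nsets B t)"
    using \<pi> bij_betw_nsets[OF \<pi>(1)] by (intro exI[of _ "(`) \<pi>"]) auto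
qed

section \<open>The greedy algorithm as a single scan\<close>

lemma find_append_Cons:
  assumes "\<forall>x\<in>set xs. \<not> P x" and "P y"
  shows "find P (xs @ y # ys) = Some y"
  using assms by (induction xs) auto

definition scan :: "nat \<Rightarrow> nat set list \<Rightarrow> nat set set" where
  "scan t = foldl (\<lambda>C B. if available t C B then insert B C else C) {}"

lemma scan_Nil [simp]: "scan t [] = {}"
  and scan_snoc: "scan t (xs @ [B]) = (if available t (scan t xs) B then insert B (scan t xs) else scan t xs)"
  by (simp_all add: scan_def)

lemma greedy_chosen_eq_scan:
  assumes "\<And>B. B \<in> set ord \<Longrightarrow> nsets B t \<noteq> {}"
  shows "greedy_chosen t ord = scan t ord"
proof -
  let ?c = "\<lambda>C. \<exists>B\<in>set ord. available t C B"
    and ?b = "\<lambda>C. insert (the (find (available t C) ord)) C"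
  have "while ?c ?b (scan t xs) = scan t ord"
    if "ord = xs @ ys" and "\<forall>B\<in>set xs. \<not> available t (scan t xs) B" for xs ys
    using that
  proof (induction ys arbitrary: xs)
    case Nil
    then show ?case
      by (subst while_unfold) auto
  next
    case (Cons y ys)
    have IH: "while ?c ?b (scan t (xs @ [y])) = scan t ord"
    proof (rule Cons.IH)
      show "ord = (xs @ [y]) @ ys"
        using Cons.prems by simp
      show "\<forall>B\<in>set (xs @ [y]). \<not> available t (scan t (xs @ [y])) B"
      proof (cases "available t (scan t xs) y")
        case True
        then have eq: "scan t (xs @ [y]) = insert y (scan t xs)"
          by (simp add: scan_snoc)
        have "\<not> available t (insert y (scan t xs)) B" if "\<not> available t (scan t xs) B" for B
          using that by (auto simp: available_def covered_def)
        \<comment> \<open>A block just chosen covers its own \<open>t\<close>-subsets, and by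
          assumption it has one.\<close>
        moreover have "\<not> available t (insert y (scan t xs)) y"
          using assms[of y] Cons.prems(1) by (auto simp: available_def covered_def nsets_def)
        ultimately show ?thesis
          using Cons.prems(2) by (auto simp: eq)
      qed (use Cons.prems in \<open>auto simp: scan_snoc\<close>)
    qed
    show ?case
    proof (cases "available t (scan t xs) y")
      case True
      have "find (available t (scan t xs)) ord = Some y"
        unfolding Cons.prems(1) by (intro find_append_Cons True Cons.prems(2))
      moreover have "?c (scan t xs)"
        using True Cons.prems(1) by auto
      ultimately have "while ?c ?b (scan t xs) = while ?c ?b (insert y (scan t xs))"
        by (subst while_unfold) simp
      with IH True show ?thesis
        by (simp add: scan_snoc)
    next
      case False
      with IH show ?thesis
        by (simp add: scan_snoc)
    qed
  qed
  from this[of "[]" ord] show ?thesis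
    by (simp add: greedy_chosen_def)
qed

lemma le_mult_choose:
  assumes "1 \<le> t" and "t \<le> n"
  shows "n \<le> t * (n choose t)"
proof -
  have "1 \<le> (n - 1) choose (t - 1)"
    using assms by (simp add: Suc_le_eq)
  then have "n * 1 \<le> n * ((n - 1) choose (t - 1))"
    by (rule mult_le_mono2)
  then show ?thesis
    using times_binomial_minus1_eq[of t n] assms by simp
qed

lemma one_less_choose:
  assumes "1 \<le> t" and "t < n"
  shows "1 < n choose t"
proof -
  have "t * 1 < t * (n choose t)"
    using le_mult_choose[of t n] assms by linarith
  then show ?thesis
    by (rule mult_less_cancel1[THEN iffD1, THEN conjunct2])
qed

section \<open>Density of the greedy covering\<close>

context
  fixes k t v :: nat
  assumes t: "t < k" and v: "k \<le> v"
begin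

interpretation H: transitive_hypergraph "nsets {..<v} k" "nsets {..<v} t" "\<lambda>B. nsets B t"
    "(k choose t) - 1" "(v - t) choose (k - t)" "(v - Suc t) choose (k - Suc t)"
  using t v by (rule transitive_hypergraph_nsets)

lemma residual_eq_uncovered:
  assumes "set xs \<subseteq> nsets {..<v} k"
  shows "H.residual xs = {T \<in> nsets {..<v} t. \<not> covered (scan t xs) T}"
  using assms
proof (induction xs rule: rev_induct)
  case Nil
  then show ?case
    by (simp add: covered_def)
next
  case (snoc B xs)
  then have B: "nsets B t \<subseteq> nsets {..<v} t"
    by (intro H.S_subset) simp
  have IH: "H.residual xs = {T \<in> nsets {..<v} t. \<not> covered (scan t xs) T}"
    using snoc by simp
  have av: "available t (scan t xs) B \<longleftrightarrow> nsets B t \<subseteq> H.residual xs"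
    using B by (auto simp: IH available_def)
  have mem: "T \<in> nsets B t \<longleftrightarrow> T \<subseteq> B" if "T \<in> nsets {..<v} t" for T
    using that by (auto simp: nsets_def)
  have "{T \<in> nsets {..<v} t. \<not> covered (insert B (scan t xs)) T} = H.residual xs - nsets B t"
    using mem by (auto simp: IH covered_def)
  then show ?case
    by (simp add: H.residual_snoc scan_snoc av H.hit_def IH)
qed

lemma finite_scan: "finite (scan t xs)"
  by (induction xs rule: rev_induct) (auto simp: scan_snoc)

text \<open>A block is chosen only while all its \<open>t\<close>-subsets are uncovered, so no
  \<open>t\<close>-set is covered twice.\<close>

lemma card_scan_superset:
  assumes "set xs \<subseteq> nsets {..<v} k" and T: "T \<in> nsets {..<v} t"
  shows "card {B \<in> scan t xs. T \<subseteq> B} = of_bool (covered (scan t xs) T)"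
  using assms(1)
proof (induction xs rule: rev_induct)
  case Nil
  then show ?case
    by (simp add: covered_def)
next
  case (snoc B xs)
  have IH: "card {B \<in> scan t xs. T \<subseteq> B} = of_bool (covered (scan t xs) T)"
    using snoc by simp
  show ?case
  proof (cases "available t (scan t xs) B \<and> T \<subseteq> B")
    case True
    then have "\<not> covered (scan t xs) T"
      using T by (auto simp: available_def nsets_def)
    then have "{B' \<in> scan t (xs @ [B]). T \<subseteq> B'} = {B}"
      using True by (auto simp: scan_snoc covered_def)
    moreover have "covered (scan t (xs @ [B])) T"
      using True by (simp add: scan_snoc covered_def)
    ultimately show ?thesis
      by simp
  next
    case False
    then have "{B' \<in> scan t (xs @ [B]). T \<subseteq> B'} = {B' \<in> scan t xs. T \<subseteq> B'}"
      by (auto simp: scan_snoc)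
    moreover have "covered (scan t (xs @ [B])) T = covered (scan t xs) T"
      using False by (auto simp: scan_snoc covered_def)
    ultimately show ?thesis
      using IH by simp
  qed
qed

text \<open>Double counting: chosen blocks contribute 1 for each \<open>t\<close>-set outside the
  residual set, and each added block contributes \<open>k choose t\<close>, whichever block
  \<open>add\<close> picks.\<close>

lemma density_greedy_covering:
  assumes add: "completion_rule v k t add" and ord: "ord \<in> permutations_of_set (nsets {..<v} k)"
  shows "density v t (greedy_covering v t add ord)
    = 1 + real ((k choose t) - 1) * (card (H.residual ord) / card (nsets {..<v} t))"
proof -
  let ?V = "nsets {..<v} t" and ?U = "H.residual ord" and ?C = "scan t ord"
  have set: "set ord \<subseteq> nsets {..<v} k"
    using ord by (simp add: permutations_of_set_def)
  have C: "greedy_chosen t ord = ?C"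
    using set H.S_nonempty by (intro greedy_chosen_eq_scan) auto
  have U: "uncovered v t ord = ?U"
    using residual_eq_uncovered[OF set] by (simp add: uncovered_def C)
  have finV: "finite ?V" and UV: "?U \<subseteq> ?V"
    using H.finite_V H.residual_subset by auto
  then have finU: "finite ?U"
    using finite_subset by blast
  have V0: "0 < card ?V"
    using t v by (simp add: zero_less_binomial)
  have kt: "1 \<le> k choose t"
    using t by (simp add: Suc_le_eq)
  have size: "size {#B \<in># greedy_covering v t add ord. T \<subseteq> B#}
      = of_bool (T \<notin> ?U) + (\<Sum>T'\<in>?U. of_bool (T \<subseteq> add ord T'))" if T: "T \<in> ?V" for T
  proof -
    have "size {#B \<in># mset_set ?C. T \<subseteq> B#} = card {B \<in> ?C. T \<subseteq> B}"
      using finite_scan by simp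
    also have "\<dots> = of_bool (T \<notin> ?U)"
      using card_scan_superset[OF set T] residual_eq_uncovered[OF set] T by simp
    finally have 1: "size {#B \<in># mset_set ?C. T \<subseteq> B#} = of_bool (T \<notin> ?U)" .
    have "size {#B \<in># image_mset (add ord) (mset_set ?U). T \<subseteq> B#} = card {T' \<in> ?U. T \<subseteq> add ord T'}"
      using finU by (simp add: filter_mset_image_mset)
    also have "\<dots> = (\<Sum>T'\<in>?U. of_bool (T \<subseteq> add ord T'))"
      by (rule sum_of_bool_filter[OF finU, symmetric])
    finally show ?thesis
      using 1 by (simp add: greedy_covering_def C U)
  qed
  have cards: "(\<Sum>T\<in>?V. of_bool (T \<subseteq> add ord T')) = k choose t" if T': "T' \<in> ?U" for T'
  proof -
    have "T' \<in> uncovered v t ord"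
      using T' by (simp add: U)
    then have "add ord T' \<in> nsets {..<v} k"
      using add ord by (auto simp: completion_rule_def)
    then have "add ord T' \<subseteq> {..<v}" and card: "card (add ord T') = k"
      by (simp_all add: nsets_def)
    then have "{T \<in> ?V. T \<subseteq> add ord T'} = nsets (add ord T') t"
      unfolding nsets_def by blast
    moreover have "(\<Sum>T\<in>?V. of_bool (T \<subseteq> add ord T')) = card {T \<in> ?V. T \<subseteq> add ord T'}"
      by (rule sum_of_bool_filter[OF finV])
    ultimately show ?thesis
      using card by simp
  qed
  have "(\<Sum>T\<in>?V. of_bool (T \<notin> ?U)) = card (?V - ?U)"
    using sum_of_bool_filter[OF finV, of "\<lambda>T. T \<notin> ?U"] by (simp only: set_diff_eq)
  then have un: "(\<Sum>T\<in>?V. of_bool (T \<notin> ?U)) = card ?V - card ?U"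
    using card_Diff_subset[OF finU UV] by simp
  have "(\<Sum>T\<in>?V. size {#B \<in># greedy_covering v t add ord. T \<subseteq> B#})
      = (\<Sum>T\<in>?V. of_bool (T \<notin> ?U)) + (\<Sum>T\<in>?V. \<Sum>T'\<in>?U. of_bool (T \<subseteq> add ord T'))"
    by (simp only: size sum.distrib cong: sum.cong)
  also have "(\<Sum>T\<in>?V. \<Sum>T'\<in>?U. of_bool (T \<subseteq> add ord T')) = (\<Sum>T'\<in>?U. k choose t)"
    by (subst sum.swap) (simp only: cards cong: sum.cong)
  finally have "(\<Sum>T\<in>?V. size {#B \<in># greedy_covering v t add ord. T \<subseteq> B#})
      = card ?V - card ?U + card ?U * (k choose t)"
    by (simp only: un sum_constant of_nat_id)
  then have "(\<Sum>T\<in>?V. real (size {#B \<in># greedy_covering v t add ord. T \<subseteq> B#}))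
      = real (card ?V - card ?U + card ?U * (k choose t))"
    by (simp only: flip: of_nat_sum)
  also have "\<dots> = real (card ?V) + real ((k choose t) - 1) * real (card ?U)"
    using kt card_mono[OF finV UV] by (simp add: of_nat_diff algebra_simps)
  finally show ?thesis
    unfolding density_def using V0 by (simp add: add_divide_distrib)
qed

text \<open>At time \<open>card (nsets {..<v} k)\<close> the whole ordering is scanned. By symmetry
  the expected uncovered fraction is the probability that the single set \<open>T\<close> stays
  uncovered.\<close>

lemma expected_density_eq:
  assumes add: "completion_rule v k t add" and T: "T \<in> nsets {..<v} t"
  shows "expected_density v k t add
    = 1 + real ((k choose t) - 1) * H.mean (card (nsets {..<v} k)) (\<lambda>U. of_bool (T \<in> U))"
proof -
  let ?V = "nsets {..<v} t" and ?E = "nsets {..<v} k"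
  let ?P = "permutations_of_set ?E"
  have E: "finite ?E" and V: "finite ?V"
    using H.finite_E H.finite_V by auto
  have V0: "0 < card ?V"
    using T V card_gt_0_iff by blast
  have "(\<Sum>\<omega>\<in>?P. real (card (H.residual \<omega>)))
      = (\<Sum>\<omega>\<in>?P. \<Sum>T'\<in>?V. of_bool (T' \<in> H.residual (take (card ?E) \<omega>)))"
  proof (rule sum.cong[OF refl])
    fix \<omega> assume "\<omega> \<in> ?P"
    then have "take (card ?E) \<omega> = \<omega>"
      by (simp add: length_finite_permutations_of_set)
    moreover have "?V \<inter> H.residual \<omega> = H.residual \<omega>"
      using H.residual_subset by blast
    ultimately show "real (card (H.residual \<omega>))
        = (\<Sum>T'\<in>?V. of_bool (T' \<in> H.residual (take (card ?E) \<omega>)))"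
      using V by simp
  qed
  also have "\<dots> = (\<Sum>T'\<in>?V. fact (card ?E) * H.mean (card ?E) (\<lambda>U. of_bool (T' \<in> U)))"
    by (subst sum.swap) (simp add: H.mean_def)
  also have "\<dots> = (\<Sum>T'\<in>?V. fact (card ?E) * H.mean (card ?E) (\<lambda>U. of_bool (T \<in> U)))"
    using H.mean_mem_eq[OF _ T] by (intro sum.cong) auto
  finally have res: "(\<Sum>\<omega>\<in>?P. real (card (H.residual \<omega>)))
      = card ?V * (fact (card ?E) * H.mean (card ?E) (\<lambda>U. of_bool (T \<in> U)))"
    by simp
  have "expected_density v k t add
      = (\<Sum>\<omega>\<in>?P. density v t (greedy_covering v t add \<omega>)) / fact (card ?E)"
    unfolding expected_density_def using E by (subst integral_pmf_of_set) auto
  also have "(\<Sum>\<omega>\<in>?P. density v t (greedy_covering v t add \<omega>))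
      = (\<Sum>\<omega>\<in>?P. 1 + real ((k choose t) - 1) * (card (H.residual \<omega>) / card ?V))"
    using density_greedy_covering[OF add] by (intro sum.cong) auto
  also have "\<dots> = fact (card ?E) + real ((k choose t) - 1) * ((\<Sum>\<omega>\<in>?P. real (card (H.residual \<omega>))) / card ?V)"
    using E by (simp add: sum.distrib sum_distrib_left sum_divide_distrib)
  also have "\<dots> / fact (card ?E)
      = 1 + real ((k choose t) - 1) * H.mean (card ?E) (\<lambda>U. of_bool (T \<in> U))"
    unfolding res using V0 by (simp add: add_divide_distrib)
  finally show ?thesis .
qed

section \<open>Stopping time and asymptotics\<close>

text \<open>Here \<open>x\<close> is the final uncovered probability. It is at most the one at an
  earlier time \<open>m\<close>, to which \<open>mean_mem_bound\<close> applies.\<close>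

lemma expected_density_bound:
  fixes D :: nat
  defines "D \<equiv> (k choose t) - 1"
  assumes add: "completion_rule v k t add" and t1: "1 \<le> t" and v2: "2 * t \<le> v"
    and large: "ln (real v) \<le> (real v - t) / k" "(k choose t) * t / v \<le> ln (real v) / (16 * D)"
  shows "\<exists>x::real\<ge>0. expected_density v k t add = 1 + D * x \<and>
    (x ^ Suc D \<le> 2 * (real (Suc D))\<^sup>2 * (24 * k + 16 * (k choose t) * t) * ((1 + ln v) / sqrt v)
      \<or> x ^ D \<le> 32 / ln v)"
proof -
  define L n N \<Delta> q where "L = ln (real v)" and "n = v choose k" and "N = (v - t) choose (k - t)"
    and "\<Delta> = (v - Suc t) choose (k - Suc t)" and "q = real N / real n"
  \<comment> \<open>Up to rounding, the time \<open>q * m\<close> is \<open>L / (8 * D)\<close>, so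
    the growth factor \<open>exp (4 * D * q * m)\<close> is at most \<open>sqrt v\<close>, while the
    additive errors are of order \<open>(1 + L) / v\<close>.\<close>
  define m where "m = nat \<lfloor>L / (8 * D * q)\<rfloor>"
  define r where "r = real (k choose t) * t"
  obtain x0 where x0: "x0 \<in> nsets {..<v} t"
    using t v by (metis all_not_in_conv card_lessThan finite_lessThan less_le_trans
        nsets_eq_empty_iff order_less_imp_le leD)
  define u where "u i = H.mean i (\<lambda>U. of_bool (x0 \<in> U))" for i
  have v0: "0 < real v"
    using t v by simp
  have kt: "1 < k choose t"
    using t1 t by (rule one_less_choose)
  have D: "1 \<le> D" "k choose t = Suc D"
    using kt by (simp_all add: D_def)
  have nN: "0 < n" "0 < N" "0 < \<Delta>"
    using t v by (simp_all add: n_def N_def \<Delta>_def)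
  have q0: "0 < q"
    using nN by (simp add: q_def)
  \<comment> \<open>Both sides count the pairs of a block and one of its \<open>t\<close>-subsets.
    With \<open>v \<le> t * (v choose t)\<close> this bounds \<open>q\<close> by a constant over
    \<open>v\<close>.\<close>
  have "real n * (k choose t) = (v choose t) * real N"
    using choose_mult[of t k v] t v by (simp add: n_def N_def flip: of_nat_mult)
  moreover have "real v \<le> t * real (v choose t)"
    using le_mult_choose[of t v] t t1 v by (simp flip: of_nat_mult)
  ultimately have qr: "q \<le> r / v"
  proof -
    assume eq: "real n * (k choose t) = (v choose t) * real N" and vt: "real v \<le> t * real (v choose t)"
    have "v * real N \<le> t * real (v choose t) * N"
      using vt by (rule mult_right_mono) simp
    also have "\<dots> = r * n"
      using eq by (simp add: r_def algebra_simps)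
    finally show ?thesis
      using nN v0 by (simp add: q_def field_simps)
  qed
  have kN: "real (k - t) * N = real (v - t) * \<Delta>"
  proof -
    have "(k - t) * N = (v - t) * \<Delta>"
      using times_binomial_minus1_eq[of "k - t" "v - t"] t by (simp add: N_def \<Delta>_def)
    then show ?thesis
      by (metis of_nat_mult)
  qed
  have "\<Delta> / N \<le> 2 * k / v"
  proof -
    have "real v * \<Delta> \<le> 2 * (real (v - t) * \<Delta>)"
      using v2 by (simp flip: mult.assoc add: mult_right_mono)
    also have "\<dots> \<le> 2 * (k * real N)"
      unfolding kN[symmetric] by (simp add: mult_right_mono)
    finally show ?thesis
      using nN v0 by (simp add: field_simps)
  qed
  have "(real v - t) / k \<le> N"
  proof -
    have "real (v - t) * 1 \<le> real (v - t) * \<Delta>"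
      using nN by (intro mult_left_mono) auto
    also have "\<dots> \<le> real k * N"
      unfolding kN[symmetric] by (intro mult_right_mono) auto
    finally show ?thesis
      using t v by (simp add: field_simps of_nat_diff)
  qed
  with large have LN: "L \<le> N"
    by (simp add: L_def)
  have L0: "0 \<le> L"
    using v0 by (simp add: L_def)
  have m: "q * m \<le> L / (8 * D)" "L / (8 * D) - q \<le> q * m"
  proof -
    have x: "0 \<le> L / (8 * D * q)"
      using L0 q0 by simp
    then have "real m \<le> L / (8 * D * q)" "L / (8 * D * q) - 1 \<le> m"
      unfolding m_def by linarith+
    then have "q * m \<le> q * (L / (8 * D * q))" "q * (L / (8 * D * q) - 1) \<le> q * m"
      using q0 by (intro mult_left_mono; simp)+
    moreover have "q * (L / (8 * D * q)) = L / (8 * D)"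
      using q0 by simp
    ultimately show "q * m \<le> L / (8 * D)" "L / (8 * D) - q \<le> q * m"
      by (simp_all add: right_diff_distrib)
  qed
  have "2 * m \<le> n"
  proof -
    have "L / (8 * D) \<le> N / 2"
    proof -
      have "L / (8 * D) \<le> L / 2"
        using L0 D(1) by (intro divide_left_mono) auto
      also have "\<dots> \<le> N / 2"
        using LN by simp
      finally show ?thesis .
    qed
    with m(1) have "q * m \<le> N / 2"
      by linarith
    then have "2 * real m \<le> n"
      using nN by (simp add: q_def field_simps)
    then show ?thesis
      by linarith
  qed
  then have m2: "2 * m \<le> card (nsets {..<v} k)"
    by (simp add: n_def)
  \<comment> \<open>Rounding \<open>m\<close> down costs at most \<open>q\<close>, which the second
    part of \<open>large\<close> bounds by half of \<open>L / (8 * D)\<close>.\<close>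
  have qL: "L / (16 * D) \<le> q * m"
  proof -
    have "q \<le> L / (16 * D)"
      using qr large(2) by (simp add: r_def L_def)
    moreover have "L / (8 * D) = L / (16 * D) + L / (16 * D)"
      by simp
    ultimately show ?thesis
      using m(2) by linarith
  qed
  have cov: "H.cov_bound m \<le> (24 * k + 16 * r) * ((1 + L) / sqrt v)"
  proof -
    \<comment> \<open>From \<open>12 * (\<Delta> / N) \<le> 24 * k / v\<close> and
      \<open>16 * q \<le> 16 * r / v\<close>; the initial value \<open>8 * q\<close> is absorbed as
      well.\<close>
    define K where "K = 24 * k + 16 * r"
    have K: "0 \<le> K" "8 * r \<le> K"
      by (simp_all add: K_def r_def)
    have "(1 + 4 * D * q) ^ m \<le> exp (4 * D * q) ^ m"
      using q0 by (intro power_mono exp_ge_add_one_self) simp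
    also have "\<dots> = exp (4 * D * (q * m))"
      by (simp add: exp_of_nat_mult[symmetric] mult_ac)
    also have "\<dots> \<le> exp (L / 2)"
      using mult_left_mono[OF m(1), of "4 * D"] D(1) by simp
    also have "\<dots> = sqrt v"
      using v0 by (simp add: L_def powr_half_sqrt[symmetric] powr_def)
    finally have 1: "(1 + 4 * D * q) ^ m \<le> sqrt v" .
    have "12 * \<Delta> / n = q * (12 * (\<Delta> / N))"
      using nN by (simp add: q_def)
    then have "m * (12 * \<Delta> / n + 16 * q\<^sup>2) = (q * m) * (12 * (\<Delta> / N) + 16 * q)"
      by (simp add: power2_eq_square algebra_simps)
    also have "\<dots> \<le> L * (12 * (2 * k / v) + 16 * (r / v))"
    proof (rule mult_mono)
      have "L / (8 * D) \<le> L / 1"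
        using L0 D(1) by (intro divide_left_mono) auto
      with m(1) show "q * m \<le> L"
        by simp
      show "12 * (\<Delta> / N) + 16 * q \<le> 12 * (2 * k / v) + 16 * (r / v)"
        using qr \<open>\<Delta> / N \<le> 2 * k / v\<close> by linarith
    qed (use L0 q0 in auto)
    also have "\<dots> = L * (K / v)"
      by (simp add: K_def add_divide_distrib)
    finally have "8 * q + m * (12 * \<Delta> / n + 16 * q\<^sup>2) \<le> 8 * (r / v) + L * (K / v)"
      using qr by linarith
    also have "\<dots> \<le> K / v + L * (K / v)"
      using K(2) v0 by (simp add: divide_right_mono)
    finally have 2: "8 * q + m * (12 * \<Delta> / n + 16 * q\<^sup>2) \<le> K * (1 + L) / v"
      by (simp add: algebra_simps add_divide_distrib)
    have "H.cov_bound m = (1 + 4 * D * q) ^ m * (8 * q + m * (12 * \<Delta> / n + 16 * q\<^sup>2))"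
      unfolding H.cov_bound_def Let_def D_def q_def N_def n_def \<Delta>_def by simp
    also have "\<dots> \<le> sqrt v * (K * (1 + L) / v)"
      using q0 by (intro mult_mono 1 2) auto
    also have "\<dots> = K * ((1 + L) / sqrt v)"
      using v0 by (simp add: field_simps)
    finally show ?thesis
      by (simp add: K_def)
  qed
  define x where "x = u (card (nsets {..<v} k))"
  have x: "0 \<le> x" "x \<le> u m"
    using m2 by (auto simp: x_def u_def H.mean_of_bool_nonneg intro!: H.mean_mem_antimono)
  have "u m ^ Suc D \<le> 2 * (real (Suc D))\<^sup>2 * H.cov_bound m \<or> D * q * m * u m ^ D \<le> 2"
    using H.mean_mem_bound[OF m2 x0] by (simp add: u_def D_def q_def N_def n_def)
  then have "x ^ Suc D \<le> 2 * (real (Suc D))\<^sup>2 * (24 * k + 16 * (k choose t) * t) * ((1 + L) / sqrt v)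
      \<or> x ^ D \<le> 32 / L"
  proof
    assume "u m ^ Suc D \<le> 2 * (real (Suc D))\<^sup>2 * H.cov_bound m"
    also have "\<dots> \<le> 2 * (real (Suc D))\<^sup>2 * ((24 * k + 16 * r) * ((1 + L) / sqrt v))"
      by (intro mult_left_mono cov) simp
    finally have "u m ^ Suc D \<le> 2 * (real (Suc D))\<^sup>2 * ((24 * k + 16 * r) * ((1 + L) / sqrt v))" .
    with power_mono[OF x(2,1), of "Suc D"] show ?thesis
      by (simp add: r_def mult.assoc)
  next
    assume *: "D * q * m * u m ^ D \<le> 2"
    have "L / 16 * x ^ D \<le> D * (q * m) * u m ^ D"
    proof (rule mult_mono)
      show "L / 16 \<le> D * (q * m)"
        using mult_left_mono[OF qL, of D] D(1) by simp
    qed (use x L0 q0 in \<open>auto intro: power_mono\<close>)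
    also have "\<dots> \<le> 2"
      using * by (simp add: mult_ac)
    finally have "L * x ^ D \<le> 32"
      by simp
    moreover have "0 < L"
      using v2 t1 by (simp add: L_def)
    ultimately show ?thesis
      by (simp add: field_simps)
  qed
  moreover have "expected_density v k t add = 1 + D * x"
    unfolding D_def x_def u_def by (rule expected_density_eq[OF add x0])
  ultimately show ?thesis
    using x(1) unfolding L_def by blast
qed

end

text \<open>Both alternatives of \<open>expected_density_bound\<close> give
  \<open>x \<le> 32 * p\<close>, where \<open>p\<close> is the claimed rate: the second by taking
  \<open>D\<close>-th roots, the first because a logarithm over \<open>sqrt v\<close> is eventually
  below every power of \<open>1 / ln v\<close>.\<close>

theorem corollary2:
  fixes k t :: nat
  assumes "1 \<le> t" and "t < k"
  shows "\<exists>c>0. \<forall>\<^sub>F v in sequentially. \<forall>add. completion_rule v k t add \<longrightarrow>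
           \<bar>expected_density v k t add - 1\<bar>
             \<le> c * ln (real v) powr (- 1 / real ((k choose t) - 1))"
proof -
  define D where "D = (k choose t) - 1"
  define K where "K = 2 * (real (Suc D))\<^sup>2 * (24 * k + 16 * (k choose t) * t)"
  have D: "1 \<le> D"
    using one_less_choose[OF assms] by (simp add: D_def)
  define R where "R = real (k choose t) * real t"
  \<comment> \<open>Chosen so that \<open>p ^ Suc D = L powr (- a)\<close>.\<close>
  define a where "a = (1 + 1 / real D)"
  have "0 < a" "0 < K" "0 < real D" "0 < R" "0 < real k"
    using D assms by (auto simp: a_def K_def R_def intro!: mult_pos_pos add_pos_pos)
  have ev: "\<forall>\<^sub>F v in sequentially. K * ((1 + ln (real v)) / sqrt (real v)) \<le> ln (real v) powr (- a)"
    using \<open>0 < a\<close> \<open>0 < K\<close> by real_asymp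
  have ev2: "\<forall>\<^sub>F v in sequentially. ln (real v) \<le> (real v - t) / k"
    using \<open>0 < real k\<close> by real_asymp
  have ev3: "\<forall>\<^sub>F v in sequentially. R / real v \<le> ln (real v) / (16 * D)"
    using \<open>0 < real D\<close> \<open>0 < R\<close> by real_asymp
  have "\<forall>\<^sub>F v in sequentially. \<forall>add. completion_rule v k t add \<longrightarrow>
           \<bar>expected_density v k t add - 1\<bar> \<le> (32 * D) * ln (real v) powr (- 1 / real D)"
    using ev ev2 ev3 eventually_ge_at_top[of "max k (max (2 * t) 2)"]
  proof eventually_elim
    case (elim v)
    define L p where "L = ln (real v)" and "p = L powr (- 1 / D)"
    have L: "0 < L"
      using elim(4) by (simp add: L_def)
    have p: "0 < p"
      using L by (simp add: p_def)
    show ?case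
    proof (intro allI impI)
      fix add assume "completion_rule v k t add"
      then obtain x :: real where x: "0 \<le> x" "expected_density v k t add = 1 + D * x"
        and cases: "x ^ Suc D \<le> K * ((1 + L) / sqrt v) \<or> x ^ D \<le> 32 / L"
        using expected_density_bound[of t k v add] elim assms
        by (auto simp: D_def K_def L_def R_def)
      from cases have "x \<le> 32 * p"
      proof
        assume "x ^ Suc D \<le> K * ((1 + L) / sqrt v)"
        also have "\<dots> \<le> L powr (- a)"
          using elim(1) by (simp add: L_def)
        also have "\<dots> = p ^ Suc D"
        proof -
          have "p ^ Suc D = L powr (- 1 / D * Suc D)"
            using L unfolding p_def by (subst powr_realpow[symmetric]) (simp_all add: powr_powr)
          also have "- 1 / D * Suc D = - a"
            using D by (simp add: a_def field_simps)
          finally show ?thesis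
            by simp
        qed
        finally have "x ^ Suc D \<le> p ^ Suc D" .
        then have "x \<le> p"
          by (rule power_le_imp_le_base) (use p in simp)
        with p show ?thesis
          by linarith
      next
        assume "x ^ D \<le> 32 / L"
        also have "\<dots> = 32 ^ 1 * p ^ D"
        proof -
          have "p ^ D = L powr (- 1 / D * D)"
            using L unfolding p_def by (subst powr_realpow[symmetric]) (simp_all add: powr_powr)
          also have "- 1 / D * D = - 1"
            using D by simp
          finally show ?thesis
            using L by (simp add: powr_minus divide_simps)
        qed
        \<comment> \<open>Since \<open>D\<close> is at least 1, the constant 32 can be raised to the
          power \<open>D\<close>, which keeps the root free of fractional powers of 32.\<close>
        also have "\<dots> \<le> 32 ^ D * p ^ D"
          using D p by (intro mult_right_mono power_increasing) auto
        also have "\<dots> = (32 * p) ^ D"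
          by (simp add: power_mult_distrib)
        finally have "x ^ D \<le> (32 * p) ^ D" .
        then show ?thesis
          using p D x(1) by (subst (asm) power_mono_iff) auto
      qed
      then have "D * x \<le> D * (32 * p)"
        by (rule mult_left_mono) simp
      then show "\<bar>expected_density v k t add - 1\<bar> \<le> (32 * D) * ln (real v) powr (- 1 / real D)"
        using x by (simp add: p_def L_def)
    qed
  qed
  then show ?thesis
    using D unfolding D_def by (intro exI[of _ "32 * real ((k choose t) - 1)"]) auto
qed

end
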